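(* Let $\mathcal{A}$ be a hyperplane arrangement in a linear subspace of $\mathbb{R}^d$. Then, as elements of $\mathfrak{S}_d[t]$, \[ \overline{\mathcal{X}}_{\mathcal{N}(\mathcal{A})}(t) \ = \ \overline{\chi}_{\mathcal{A}}(t)\cdot\rho([\mathbb{R}^d]) \, . \]
   Context: Polyhedral cones are nonempty and contain the origin; $\mathbf{Cones}_d$ is the set of polyhedral cones in $\mathbb{R}^d$. For $S\subseteq\mathbb{R}^d$, $[S]$ is its indicator function. $\mathfrak{C}_d$ is the abelian group of functions $\mathbb{R}^d\to\mathbb{Z}$ spanned by all $[C]$, $C\in\mathbf{Cones}_d$; $\mathfrak{S}_d=\mathfrak{C}_d/\langle [C] : C\in\mathbf{Cones}_d,\ \dim C<d\rangle$ is the group of simple indicator functions and $\rho:\mathfrak{C}_d\to\mathfrak{S}_d$ the canonical projection. $\mathfrak{S}_d[t]$ denotes polynomials in $t$ with coefficients in the abelian group $\mathfrak{S}_d$ (a module over $\mathbb{Z}[t]$). For a cone $C$, $\mathcal{F}_k(C)$ is the set of $k$-dimensional nonempty faces of $C$ (including $C$ itself if $k=\dim C$). For a nonempty face $F$ of $C$, $N_FC=\{c\in\mathbb{R}^d : \langle c,x\rangle\le\langle c,y\rangle \text{ for all } x\in C,\ y\in F\}$, and $\Pi_F(C)=F+N_FC$. Define $V_k(C)=\sum_{F\in\mathcal{F}_k(C)}[\Pi_F(C)]\in\mathfrak{C}_d$. A fan $\mathcal{N}$ in $\mathbb{R}^d$ is a finite collection of polyhedral cones with a common linear hull pairwise meeting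 in faces; set $V_k(\mathcal{N})=\sum_{C\in\mathcal{N}}V_k(C)$ and $\overline{\mathcal{X}}_{\mathcal{N}}(t)=\sum_{k=0}^d\rho(V_k(\mathcal{N}))\,t^k\in\mathfrak{S}_d[t]$. A hyperplane arrangement $\mathcal{A}$ is a nonempty finite collection of linear hyperplanes in some linear subspace $L\subseteq\mathbb{R}^d$; $\mathcal{N}(\mathcal{A})$ is the fan of closures of the connected components of $L\setminus\bigcup\mathcal{A}$. For $H\in\mathcal{A}$, $\mathcal{A}\backslash H=\{H'\in\mathcal{A}:H'\ne H\}$ (in $L$) and $\mathcal{A}/H=\{H'\cap H : H'\in\mathcal{A},H'\neq H\}$ (in $H$). A $k$-singleton is an arrangement consisting of a single hyperplane in a $k$-dimensional linear subspace. The unsigned characteristic polynomial is defined recursively by $\overline{\chi}_{\mathcal{A}}(t)=t^k+t^{k-1}$ if $\mathcal{A}$ is a $k$-singleton and $\overline{\chi}_{\mathcal{A}}(t)=\overline{\chi}_{\mathcal{A}\backslash H}(t)+\overline{\chi}_{\mathcal{A}/H}(t)$ for $H\in\mathcal{A}$ if $\mathcal{A}$ has more than one hyperplane; equivalently $\overline{\chi}_{\mathcal{A}}(t)=(-1)^{\dim L}\chi_{\mathcal{A}}(-t)$ with $\chi_{\mathcal{A}}$ the usual characteristic polynomial. *)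

theory Defs
  imports
    "HOL-Analysis.Analysis"
    "HOL-Library.Function_Algebras"
    "HOL-Computational_Algebra.Polynomial"
    "HOL-Computational_Algebra.Group_Closure"
begin

section \<open>Polyhedral cones and their indicator functions\<close>

text \<open>
  \<^const>\<open>convex_cone\<close> includes nonemptiness, so every polyhedral cone contains the origin.
\<close>
definition polyhedral_cone :: "'a::euclidean_space set \<Rightarrow> bool" where
  "polyhedral_cone C \<longleftrightarrow> polyhedron C \<and> convex_cone C"

text \<open>
  Functions into the integers form an abelian group pointwise (\<^theory>\<open>HOL-Library.Function_Algebras\<close>);
  sums and differences of indicator functions below are taken in that group.
\<close>
definition cone_functions :: "('a::euclidean_space \<Rightarrow> int) set" where
  "cone_functions = group_closure {indicator C |C. polyhedral_cone C}"

definition lower_cone_functions :: "('a::euclidean_space \<Rightarrow> int) set" where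
  "lower_cone_functions =
     group_closure {indicator C |C. polyhedral_cone C \<and> aff_dim C < int DIM('a)}"

definition simple_rel :: "('a::euclidean_space \<Rightarrow> int) \<Rightarrow> ('a \<Rightarrow> int) \<Rightarrow> bool" where
  "simple_rel f g \<longleftrightarrow>
     f \<in> cone_functions \<and> g \<in> cone_functions \<and> f - g \<in> lower_cone_functions"

lemma zero_in_cone_functions: "0 \<in> cone_functions"
  by (simp add: cone_functions_def)

lemma cone_functions_add:
  "f \<in> cone_functions \<Longrightarrow> g \<in> cone_functions \<Longrightarrow> f + g \<in> cone_functions"
  by (simp add: cone_functions_def group_closure_add)

lemma cone_functions_uminus: "f \<in> cone_functions \<Longrightarrow> - f \<in> cone_functions"
  by (simp add: cone_functions_def)

lemma lower_cone_functions_add: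
  "f \<in> lower_cone_functions \<Longrightarrow> g \<in> lower_cone_functions \<Longrightarrow> f + g \<in> lower_cone_functions"
  by (simp add: lower_cone_functions_def group_closure_add)

lemma lower_cone_functions_uminus: "f \<in> lower_cone_functions \<Longrightarrow> - f \<in> lower_cone_functions"
  by (simp add: lower_cone_functions_def)

lemma simple_rel_add:
  assumes "simple_rel f f'" "simple_rel g g'"
  shows "simple_rel (f + g) (f' + g')"
proof -
  have "(f + g) - (f' + g') = (f - f') + (g - g')"
    by simp
  with assms show ?thesis
    unfolding simple_rel_def by (metis cone_functions_add lower_cone_functions_add)
qed

lemma simple_rel_uminus:
  assumes "simple_rel f f'"
  shows "simple_rel (- f) (- f')"
proof -
  have "(- f) - (- f') = - (f - f')"
    by simp
  with assms show ?thesis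
    unfolding simple_rel_def by (metis cone_functions_uminus lower_cone_functions_uminus)
qed

text \<open>
  The group of simple indicator functions, i.e. \<^const>\<open>cone_functions\<close> modulo
  \<^const>\<open>lower_cone_functions\<close>. The quotient is partial because only members of
  \<^const>\<open>cone_functions\<close> represent elements of the group.
\<close>
quotient_type (overloaded) 'a simple = "'a::euclidean_space \<Rightarrow> int" / partial: simple_rel
  morphisms rep_simple rho
proof (rule part_equivpI)
  show "\<exists>f::'a \<Rightarrow> int. simple_rel f f"
    by (rule exI[of _ 0]) (simp add: simple_rel_def zero_in_cone_functions lower_cone_functions_def)
  show "symp (simple_rel :: ('a \<Rightarrow> int) \<Rightarrow> _)"
  proof (rule sympI)
    fix f g :: "'a \<Rightarrow> int"
    assume *: "simple_rel f g"
    then have "- (f - g) \<in> lower_cone_functions"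
      unfolding simple_rel_def by (blast intro: lower_cone_functions_uminus)
    with * show "simple_rel g f"
      by (simp add: simple_rel_def)
  qed
  show "transp (simple_rel :: ('a \<Rightarrow> int) \<Rightarrow> _)"
  proof (rule transpI)
    fix f g h :: "'a \<Rightarrow> int"
    assume *: "simple_rel f g" "simple_rel g h"
    then have "(f - g) + (g - h) \<in> lower_cone_functions"
      unfolding simple_rel_def by (blast intro: lower_cone_functions_add)
    with * show "simple_rel f h"
      by (simp add: simple_rel_def)
  qed
qed

instantiation simple :: (euclidean_space) ab_group_add
begin

lift_definition zero_simple :: "'a simple" is 0
  by (simp add: simple_rel_def zero_in_cone_functions lower_cone_functions_def)

lift_definition plus_simple :: "'a simple \<Rightarrow> 'a simple \<Rightarrow> 'a simple" is "(+)"
  by (rule simple_rel_add)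

lift_definition uminus_simple :: "'a simple \<Rightarrow> 'a simple" is uminus
  by (rule simple_rel_uminus)

definition minus_simple :: "'a simple \<Rightarrow> 'a simple \<Rightarrow> 'a simple" where
  "minus_simple f g = f + - g"

instance
proof
  fix f g h :: "'a simple"
  show "f + g + h = f + (g + h)"
    by transfer (simp add: simple_rel_def add.assoc cone_functions_add lower_cone_functions_def)
  show "f + g = g + f"
    by transfer
      (simp add: simple_rel_def cone_functions_add lower_cone_functions_def add.commute)
  show "0 + f = f"
    by transfer (simp add: simple_rel_def)
  show "- f + f = 0"
    by transfer (simp add: simple_rel_def zero_in_cone_functions lower_cone_functions_def)
  show "f - g = f + - g"
    by (rule minus_simple_def)
qed

end


section \<open>Polynomials over an abelian group as a module over the integer polynomials\<close>

definition int_scale :: "int \<Rightarrow> 'a::ab_group_add \<Rightarrow> 'a" where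
  "int_scale n x = (if n \<ge> 0 then (\<Sum>i<nat n. x) else - (\<Sum>i<nat (- n). x))"

definition poly_scale :: "int poly \<Rightarrow> 'a::ab_group_add poly \<Rightarrow> 'a poly" (infixr "\<cdot>\<^sub>p" 70) where
  "p \<cdot>\<^sub>p q =
     (\<Sum>i\<le>degree p. \<Sum>j\<le>degree q. monom (int_scale (coeff p i) (coeff q j)) (i + j))"


section \<open>The polynomial of a fan\<close>

definition faces_of_dim :: "nat \<Rightarrow> 'a::euclidean_space set \<Rightarrow> 'a set set" where
  "faces_of_dim k C = {F. F face_of C \<and> F \<noteq> {} \<and> aff_dim F = int k}"

definition normal_cone_at :: "'a::euclidean_space set \<Rightarrow> 'a set \<Rightarrow> 'a set" where
  "normal_cone_at F C = {c. \<forall>x\<in>C. \<forall>y\<in>F. c \<bullet> x \<le> c \<bullet> y}"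

definition Pi_cone :: "'a::euclidean_space set \<Rightarrow> 'a set \<Rightarrow> 'a set" where
  "Pi_cone F C = {x + y |x y. x \<in> F \<and> y \<in> normal_cone_at F C}"

definition V_cone :: "nat \<Rightarrow> 'a::euclidean_space set \<Rightarrow> 'a \<Rightarrow> int" where
  "V_cone k C = (\<Sum>F\<in>faces_of_dim k C. indicator (Pi_cone F C))"

text \<open>A fan is represented by the set of its cones.\<close>
definition V_fan :: "nat \<Rightarrow> 'a::euclidean_space set set \<Rightarrow> 'a \<Rightarrow> int" where
  "V_fan k N = (\<Sum>C\<in>N. V_cone k C)"

definition fan_poly :: "'a::euclidean_space set set \<Rightarrow> 'a simple poly" where
  "fan_poly N = (\<Sum>k\<le>DIM('a). monom (rho (V_fan k N)) k)"


section \<open>Hyperplane arrangements\<close>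

definition arrangement :: "'a::euclidean_space set \<Rightarrow> 'a set set \<Rightarrow> bool" where
  "arrangement L A \<longleftrightarrow>
     subspace L \<and> finite A \<and> A \<noteq> {} \<and> (\<forall>H\<in>A. subspace H \<and> H \<subseteq> L \<and> dim L = dim H + 1)"

definition arrangement_fan :: "'a::euclidean_space set \<Rightarrow> 'a set set \<Rightarrow> 'a set set" where
  "arrangement_fan L A = closure ` components (L - \<Union>A)"

definition deletion :: "'a set set \<Rightarrow> 'a set \<Rightarrow> 'a set set" where
  "deletion A H = {H'\<in>A. H' \<noteq> H}"

definition restriction :: "'a set set \<Rightarrow> 'a set \<Rightarrow> 'a set set" where
  "restriction A H = {H' \<inter> H |H'. H' \<in> A \<and> H' \<noteq> H}"

text \<open>
  The deletion-restriction recursion, where every choice of \<^term>\<open>H\<close> is allowed. That all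
  choices lead to the same polynomial is shown in \<open>is_unsigned_charpoly_ex1\<close> below.
\<close>
inductive is_unsigned_charpoly :: "'a::euclidean_space set \<Rightarrow> 'a set set \<Rightarrow> int poly \<Rightarrow> bool" where
  singleton: "is_unsigned_charpoly L {H} (monom 1 (dim L) + monom 1 (dim L - 1))"
| step: "is_unsigned_charpoly L A (p + q)"
    if "H \<in> A" and "card A > 1"
      and "is_unsigned_charpoly L (deletion A H) p"
      and "is_unsigned_charpoly H (restriction A H) q"

definition unsigned_charpoly :: "'a::euclidean_space set \<Rightarrow> 'a set set \<Rightarrow> int poly" where
  "unsigned_charpoly L A = (THE p. is_unsigned_charpoly L A p)"

lemma arrangement_deletion:
  assumes "arrangement L A" "H \<in> A" "card A > 1"
  shows "arrangement L (deletion A H)"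
proof -
  have "deletion A H \<subseteq> A" "deletion A H = A - {H}"
    by (auto simp: deletion_def)
  moreover have "A - {H} \<noteq> {}"
  proof
    assume "A - {H} = {}"
    with assms(2) have "A = {H}"
      by blast
    with assms(3) show False
      by simp
  qed
  ultimately show ?thesis
    using assms(1) finite_subset unfolding arrangement_def by (metis subsetD)
qed

lemma card_deletion:
  assumes "arrangement L A" "H \<in> A"
  shows "card (deletion A H) = card A - 1"
proof -
  have "deletion A H = A - {H}"
    by (auto simp: deletion_def)
  then show ?thesis
    using assms by (simp add: arrangement_def)
qed

lemma card_restriction:
  assumes "arrangement L A" "H \<in> A"
  shows "card (restriction A H) \<le> card A - 1"
proof -
  have "restriction A H = (\<lambda>H'. H' \<inter> H) ` deletion A H"
    by (auto simp: restriction_def deletion_def)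
  moreover have "finite (deletion A H)"
    using assms by (simp add: arrangement_def deletion_def)
  ultimately show ?thesis
    using card_deletion[OF assms] card_image_le by metis
qed

lemma dim_Int_hyperplanes:
  fixes L :: "'a::euclidean_space set"
  assumes "arrangement L A" "H \<in> A" "K \<in> A" "H \<noteq> K"
  shows "dim H = dim (K \<inter> H) + 1"
proof -
  have H: "subspace H" "H \<subseteq> L" "dim L = dim H + 1"
    and K: "subspace K" "K \<subseteq> L" "dim L = dim K + 1" and L: "subspace L"
    using assms unfolding arrangement_def by blast+
  define S where "S = {x + y |x y. x \<in> K \<and> y \<in> H}"
  have sums: "dim S + dim (K \<inter> H) = dim K + dim H"
    unfolding S_def by (rule dim_sums_Int) (use H K in auto)
  have subS: "subspace S"
    unfolding S_def by (rule subspace_sums) (use H K in auto)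
  have "S \<subseteq> L"
    unfolding S_def using H(2) K(2) subspace_add[OF L] by (auto simp: subset_iff)
  then have "dim S \<le> dim L"
    by (rule dim_subset)
  have "H \<subseteq> S"
  proof
    fix x assume "x \<in> H"
    then show "x \<in> S"
      unfolding S_def using subspace_0[OF K(1)] by force
  qed
  have "K \<subseteq> S"
  proof
    fix x assume "x \<in> K"
    then show "x \<in> S"
      unfolding S_def using subspace_0[OF H(1)] by force
  qed
  have "dim S > dim H"
  proof (rule ccontr)
    assume "\<not> dim S > dim H"
    then have "S = H" "S = K"
      using subspace_dim_equal[OF H(1) subS \<open>H \<subseteq> S\<close>] subspace_dim_equal[OF K(1) subS \<open>K \<subseteq> S\<close>]
        H K by auto
    with assms(4) show False
      by simp
  qed
  with sums H K \<open>dim S \<le> dim L\<close> show ?thesis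
    by linarith
qed

lemma arrangement_restriction:
  fixes L :: "'a::euclidean_space set"
  assumes "arrangement L A" "H \<in> A" "card A > 1"
  shows "arrangement H (restriction A H)"
proof -
  have *: "restriction A H = (\<lambda>H'. H' \<inter> H) ` deletion A H"
    by (auto simp: restriction_def deletion_def)
  have "deletion A H \<noteq> {}" "finite (deletion A H)"
    using arrangement_deletion[OF assms] by (auto simp: arrangement_def)
  moreover have "subspace (K \<inter> H) \<and> K \<inter> H \<subseteq> H \<and> dim H = dim (K \<inter> H) + 1"
    if "K \<in> deletion A H" for K
  proof -
    have "K \<in> A" "H \<noteq> K"
      using that by (auto simp: deletion_def)
    moreover from this have "subspace K" "subspace H"
      using assms unfolding arrangement_def by blast+
    ultimately show ?thesis
      using dim_Int_hyperplanes[OF assms(1,2)] by (simp add: subspace_inter)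
  qed
  moreover have "subspace H"
    using assms unfolding arrangement_def by blast
  ultimately show ?thesis
    unfolding * arrangement_def by blast
qed

lemma is_unsigned_charpoly_ex1:
  fixes L :: "'a::euclidean_space set"
  assumes "arrangement L A"
  shows "\<exists>!p. is_unsigned_charpoly L A p"
  using assms
proof (induction "card A" arbitrary: L A rule: less_induct)
  case less
  let ?c = "unsigned_charpoly :: 'a set \<Rightarrow> _"
  note arr = less.prems
  have ex1: "\<exists>!p. is_unsigned_charpoly M B p" if "arrangement M B" "card B < card A"
    for M :: "'a set" and B
    by (rule less.hyps[OF that(2,1)])
  have c: "is_unsigned_charpoly M B p \<longleftrightarrow> p = ?c M B"
    if "arrangement M B" "card B < card A" for M B p
    using theI'[OF ex1[OF that]] ex1[OF that] unfolding unsigned_charpoly_def by blast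
  have c_single: "?c M {K} = monom 1 (dim M) + monom 1 (dim M - 1)"
    if "arrangement M {K}" "card A > 1" for M K
    using c[OF that(1)] that(2) is_unsigned_charpoly.singleton[of M K] by simp
  have c_step: "?c M B = ?c M (deletion B K) + ?c K (restriction B K)"
    if "arrangement M B" "card B < card A" "K \<in> B" "card B > 1" for M B K
  proof -
    have "is_unsigned_charpoly M (deletion B K) (?c M (deletion B K))"
      using c arrangement_deletion[OF that(1,3,4)] card_deletion[OF that(1,3)] that(2) by force
    moreover have "is_unsigned_charpoly K (restriction B K) (?c K (restriction B K))"
      using c arrangement_restriction[OF that(1,3,4)] card_restriction[OF that(1,3)] that(2) by force
    ultimately show ?thesis
      using is_unsigned_charpoly.step[OF that(3,4)] c[OF that(1,2)] by metis
  qed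
  show ?case
  proof (cases "card A > 1")
    case False
    moreover have "card A \<noteq> 0"
      using arr by (simp add: arrangement_def)
    ultimately have "card A = 1"
      by simp
    then obtain H where "A = {H}"
      by (auto simp: card_1_singleton_iff)
    have "p = monom 1 (dim L) + monom 1 (dim L - 1)" if "is_unsigned_charpoly L A p" for p
      using that by cases (use \<open>A = {H}\<close> in auto)
    moreover have "is_unsigned_charpoly L A (monom 1 (dim L) + monom 1 (dim L - 1))"
      unfolding \<open>A = {H}\<close> by (rule is_unsigned_charpoly.singleton)
    ultimately show ?thesis
      by blast
  next
    case big: True
    define r where "r H = ?c L (deletion A H) + ?c H (restriction A H)" for H
    have del: "arrangement L (deletion A H)" "card (deletion A H) < card A"
      and res: "arrangement H (restriction A H)" "card (restriction A H) < card A" if "H \<in> A" for H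
      using arrangement_deletion[OF arr that big] card_deletion[OF arr that]
        arrangement_restriction[OF arr that big] card_restriction[OF arr that] big by auto
    have r_eq: "r H = r K" if "H \<in> A" "K \<in> A" "H \<noteq> K" for H K
    proof (cases "card A = 2")
      case True
      have A: "A = {H, K}"
        using True that by (auto simp: card_2_iff)
      have eqs: "deletion A H = {K}" "deletion A K = {H}"
        "restriction A H = {K \<inter> H}" "restriction A K = {H \<inter> K}"
        using that(3) unfolding A by (auto simp: deletion_def restriction_def)
      have "dim H = dim K"
        using arr that unfolding arrangement_def by (metis add_right_cancel)
      moreover have "arrangement L {K}" "arrangement L {H}"
        "arrangement H {K \<inter> H}" "arrangement K {H \<inter> K}"
        using del(1) res(1) that unfolding eqs[symmetric] by blast+
      ultimately show ?thesis
        using c_single[OF _ big] by (simp add: r_def eqs)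
    next
      case False
      with big have big3: "card A > 2"
        by simp
      have K: "K \<in> deletion A H" and H: "H \<in> deletion A K"
        using that by (auto simp: deletion_def)
      have cd: "card (deletion A H) > 1" "card (deletion A K) > 1"
        using big3 card_deletion[OF arr] that by auto
      have dd: "deletion (deletion A H) K = deletion (deletion A K) H"
        by (auto simp: deletion_def)
      have e1: "?c L (deletion A H) =
          ?c L (deletion (deletion A H) K) + ?c K (restriction (deletion A H) K)"
        by (rule c_step) (use del that K cd in auto)
      have e2: "?c L (deletion A K) =
          ?c L (deletion (deletion A H) K) + ?c H (restriction (deletion A K) H)"
        unfolding dd by (rule c_step) (use del that H cd in auto)
      show ?thesis
      proof (cases "\<exists>J\<in>A. J \<noteq> H \<and> J \<noteq> K \<and> H \<inter> K \<subseteq> J")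
        case True
        then obtain J where J: "J \<in> A" "J \<noteq> H" "J \<noteq> K" "H \<inter> K \<subseteq> J"
          by blast
        have trace: "J \<inter> K = H \<inter> K" if "J \<in> A" "J \<noteq> K" "H \<in> A" "H \<noteq> K" "H \<inter> K \<subseteq> J" "K \<in> A" for H K
        proof -
          have "H \<inter> K = J \<inter> K"
          proof (rule subspace_dim_equal)
            show "subspace (H \<inter> K)" "subspace (J \<inter> K)"
              using arr that unfolding arrangement_def by (blast intro: subspace_inter)+
            show "H \<inter> K \<subseteq> J \<inter> K"
              using that by blast
            show "dim (J \<inter> K) \<le> dim (H \<inter> K)"
              using dim_Int_hyperplanes[OF arr \<open>K \<in> A\<close> \<open>J \<in> A\<close>]
                dim_Int_hyperplanes[OF arr \<open>K \<in> A\<close> \<open>H \<in> A\<close>] that by simp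
          qed
          then show ?thesis ..
        qed
        have "J \<inter> K = H \<inter> K" "J \<inter> H = K \<inter> H"
          using trace[of K H] trace[of H K] J that by (auto simp: Int_commute)
        then have "restriction (deletion A H) K = restriction A K"
          "restriction (deletion A K) H = restriction A H"
          using J that unfolding restriction_def deletion_def by blast+
        with e1 e2 show ?thesis
          by (simp add: r_def)
      next
        case False
        have rd: "restriction (deletion A K) H = deletion (restriction A H) (K \<inter> H)"
          if "\<forall>J\<in>A. J \<noteq> H \<longrightarrow> J \<noteq> K \<longrightarrow> \<not> H \<inter> K \<subseteq> J" for H K
          using that unfolding restriction_def deletion_def by blast
        have rr: "restriction (restriction A H) (K \<inter> H) \<subseteq> restriction (restriction A K) (H \<inter> K)"
          if "\<forall>J\<in>A. J \<noteq> H \<longrightarrow> J \<noteq> K \<longrightarrow> \<not> H \<inter> K \<subseteq> J" for H K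
        proof
          fix X assume "X \<in> restriction (restriction A H) (K \<inter> H)"
          then obtain J where J: "J \<in> A" "J \<noteq> H" "J \<inter> H \<noteq> K \<inter> H" "X = (J \<inter> H) \<inter> (K \<inter> H)"
            unfolding restriction_def by blast
          then have "J \<noteq> K"
            by auto
          with that J have "J \<inter> K \<noteq> H \<inter> K"
            by blast
          moreover have "X = (J \<inter> K) \<inter> (H \<inter> K)"
            using J by blast
          ultimately show "X \<in> restriction (restriction A K) (H \<inter> K)"
            unfolding restriction_def using \<open>J \<in> A\<close> \<open>J \<noteq> K\<close> by blast
        qed
        have not: "\<forall>J\<in>A. J \<noteq> H \<longrightarrow> J \<noteq> K \<longrightarrow> \<not> H \<inter> K \<subseteq> J"
          "\<forall>J\<in>A. J \<noteq> K \<longrightarrow> J \<noteq> H \<longrightarrow> \<not> K \<inter> H \<subseteq> J"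
          using False by (auto simp: Int_commute)
        have big_res: "card (restriction A H) > 1"
          if "H \<in> A" "K \<in> A" "H \<noteq> K" "\<forall>J\<in>A. J \<noteq> H \<longrightarrow> J \<noteq> K \<longrightarrow> \<not> H \<inter> K \<subseteq> J" for H K
        proof -
          have "finite A"
            using arr by (simp add: arrangement_def)
          have "card {H, K} < card A"
            using big3 that by simp
          then obtain J where J: "J \<in> A" "J \<noteq> H" "J \<noteq> K"
            by (metis \<open>finite A\<close> card_mono finite.emptyI finite_insert insertCI leD subsetI)
          have "{K \<inter> H, J \<inter> H} \<subseteq> restriction A H"
            using J that unfolding restriction_def by blast
          moreover have "K \<inter> H \<noteq> J \<inter> H"
            using J that by blast
          moreover have "finite (restriction A H)"
            using res that by (simp add: arrangement_def)
          ultimately show ?thesis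
            by (metis card_2_iff card_mono one_less_numeral_iff order_less_le_trans semiring_norm(76))
        qed
        have KH: "K \<inter> H \<in> restriction A H" and HK: "H \<inter> K \<in> restriction A K"
          using that unfolding restriction_def by blast+
        have f1: "?c H (restriction A H) = ?c H (deletion (restriction A H) (K \<inter> H))
            + ?c (K \<inter> H) (restriction (restriction A H) (K \<inter> H))"
          by (rule c_step) (use res that KH big_res[OF that not(1)] in auto)
        have f2: "?c K (restriction A K) = ?c K (deletion (restriction A K) (H \<inter> K))
            + ?c (H \<inter> K) (restriction (restriction A K) (H \<inter> K))"
          by (rule c_step) (use res that HK big_res[OF that(2,1) that(3)[symmetric] not(2)] in auto)
        have "restriction (restriction A H) (K \<inter> H) = restriction (restriction A K) (H \<inter> K)"
          using rr[OF not(1)] rr[OF not(2)] by blast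
        then show ?thesis
          unfolding r_def e1 e2 f1 f2 rd[OF not(1)] rd[OF not(2)] by (simp add: Int_commute)
      qed
    qed
    have "is_unsigned_charpoly L A p \<longleftrightarrow> (\<exists>H\<in>A. p = r H)" for p
    proof
      assume "is_unsigned_charpoly L A p"
      then show "\<exists>H\<in>A. p = r H"
      proof cases
        case (singleton H)
        with big show ?thesis
          by simp
      next
        case (step H p1 p2)
        then show ?thesis
          using c del res unfolding r_def by metis
      qed
    next
      assume "\<exists>H\<in>A. p = r H"
      then show "is_unsigned_charpoly L A p"
        unfolding r_def using is_unsigned_charpoly.step[OF _ big] c del res by metis
    qed
    moreover obtain H where "H \<in> A"
      using arr by (auto simp: arrangement_def)
    ultimately show ?thesis
      using r_eq by metis
  qed
qed

lemma is_unsigned_charpoly_iff: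
  assumes "arrangement L A"
  shows "is_unsigned_charpoly L A p \<longleftrightarrow> p = unsigned_charpoly L A"
  using theI'[OF is_unsigned_charpoly_ex1[OF assms]] is_unsigned_charpoly_ex1[OF assms]
  unfolding unsigned_charpoly_def by blast

lemma unsigned_charpoly_singleton:
  assumes "arrangement L {H}"
  shows "unsigned_charpoly L {H} = monom 1 (dim L) + monom 1 (dim L - 1)"
  using is_unsigned_charpoly_iff[OF assms] is_unsigned_charpoly.singleton by metis

lemma unsigned_charpoly_step:
  assumes "arrangement L A" "H \<in> A" "card A > 1"
  shows "unsigned_charpoly L A =
    unsigned_charpoly L (deletion A H) + unsigned_charpoly H (restriction A H)"
  using is_unsigned_charpoly.step[OF assms(2,3)] is_unsigned_charpoly_iff[OF assms(1)]
    is_unsigned_charpoly_iff[OF arrangement_deletion[OF assms]]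
    is_unsigned_charpoly_iff[OF arrangement_restriction[OF assms]] by metis

end

theory Submission
  imports Defs
begin

text \<open>
  The theorem compares coefficients, so the claim is that for each \<open>k\<close> the function that counts the
  pairs of a region \<open>C\<close> and a \<open>k\<close>-dimensional face \<open>F\<close> of \<open>C\<close> with \<open>x \<in> Pi_cone F C\<close> is, up to lower
  dimensional cones, the constant \<open>k\<close>-th coefficient of the unsigned characteristic polynomial. Two
  functions spanned by cones that agree off finitely many hyperplanes agree in the quotient
  (\<open>rho_eq_if_generically_eq\<close>). The counting may therefore be done at a generic point \<open>x\<close>, and there it
  becomes geometric: \<open>x \<in> Pi_cone F C\<close> holds exactly if the point of \<open>C\<close> nearest to \<open>x\<close> lies in the
  relative interior of \<open>F\<close> (\<open>generic_mem_Pi_cone_iff\<close>). So \<open>V_cone k C x\<close> is \<open>1\<close> or \<open>0\<close>, according to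
  whether the relatively open face that contains the nearest point has dimension \<open>k\<close>.

  The heart of the proof is that \<open>V_cone k\<close> is generically a valuation (\<open>generic_V_cone_split\<close>): if a
  hyperplane \<open>H\<close> divides \<open>C\<close> into closed halves \<open>P\<close> and \<open>N\<close>, then \<open>V_cone k P + V_cone k N =
  V_cone k C + V_cone k (C \<inter> H)\<close>. Indeed, if the point of \<open>C\<close> nearest to \<open>x\<close> is strictly inside \<open>P\<close>, it
  is also the nearest point of \<open>P\<close>, while the nearest point of \<open>N\<close> must lie on \<open>H\<close> and is therefore the
  nearest point of \<open>C \<inter> H\<close>.

  Let now \<open>H\<close> be a member of the arrangement \<open>A\<close>. The regions of \<open>A\<close> are the pieces into which \<open>H\<close> cuts
  the regions of the deletion, and the regions of the restriction are their slices by \<open>H\<close>. Summing the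
  valuation property over the regions of the deletion shows that the generic value of the count satisfies
  the recursion that defines the unsigned characteristic polynomial
  (\<open>generic_region_sum_deletion_restriction\<close>). The recursion can be carried down to the empty arrangement
  in a subspace \<open>L\<close>, where the count is \<open>1\<close> in degree \<open>dim L\<close> and \<open>0\<close> in all other degrees
  (\<open>region_sum_empty\<close>); for a single hyperplane this yields \<open>t\<^sup>k + t\<^sup>k\<^sup>-\<^sup>1\<close> with \<open>k = dim L\<close>.
\<close>

section \<open>Pi-cones are polyhedral\<close>

lemma polyhedral_cone_halfspaces:
  fixes A :: "'a::euclidean_space set"
  assumes "finite A"
  shows "polyhedral_cone {x. \<forall>a\<in>A. a \<bullet> x \<le> 0}"
proof -
  have "{x. \<forall>a\<in>A. a \<bullet> x \<le> 0} = (\<Inter>a\<in>A. {x. a \<bullet> x \<le> 0})"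
    by auto
  moreover have "polyhedron (\<Inter>a\<in>A. {x. a \<bullet> x \<le> 0})"
    using assms by (intro polyhedron_Inter) (auto simp: polyhedron_halfspace_le)
  moreover have "convex_cone (\<Inter>a\<in>A. {x. a \<bullet> x \<le> 0})"
    by (intro convex_cone_Inter) (auto simp: convex_cone_halfspace_le)
  ultimately show ?thesis
    by (simp add: polyhedral_cone_def)
qed

text \<open>
  A halfspace \<open>n \<bullet> x \<le> b\<close> that contains a cone has \<open>b \<ge> 0\<close>, and scaling up a point with \<open>n \<bullet> x > 0\<close>
  would leave it, so the offset may be replaced by \<open>0\<close>.
\<close>
lemma polyhedral_cone_halfspacesE:
  fixes C :: "'a::euclidean_space set"
  assumes "polyhedral_cone C"
  obtains A where "finite A" "C = {x. \<forall>a\<in>A. a \<bullet> x \<le> 0}"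
proof -
  have C: "polyhedron C" "convex_cone C"
    using assms by (auto simp: polyhedral_cone_def)
  obtain F where F: "finite F" "C = \<Inter>F" "\<forall>h\<in>F. \<exists>a b. a \<noteq> 0 \<and> h = {x. a \<bullet> x \<le> b}"
    using C(1) unfolding polyhedron_def by blast
  then obtain n b where nb: "\<And>h x. h \<in> F \<Longrightarrow> x \<in> h \<longleftrightarrow> n h \<bullet> x \<le> b h"
    by (metis mem_Collect_eq)
  have b: "b h \<ge> 0" if "h \<in> F" for h
    using convex_cone_contains_0[OF C(2)] F(2) nb[OF that, of 0] that by auto
  have "n h \<bullet> x \<le> 0" if h: "h \<in> F" and x: "x \<in> C" for h x
  proof (rule ccontr)
    assume pos: "\<not> n h \<bullet> x \<le> 0"
    define t where "t = (b h + 1) / (n h \<bullet> x)"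
    have "t *\<^sub>R x \<in> C"
      using C(2) x b[OF h] pos by (intro convex_cone_scaleR) (auto simp: t_def)
    then have "n h \<bullet> (t *\<^sub>R x) \<le> b h"
      using F(2) nb[OF h, of "t *\<^sub>R x"] h by blast
    moreover have "n h \<bullet> (t *\<^sub>R x) = b h + 1"
      using pos by (simp add: t_def)
    ultimately show False
      by simp
  qed
  moreover have "x \<in> C" if "\<forall>h\<in>F. n h \<bullet> x \<le> 0" for x
    unfolding F(2) using nb b that by (meson InterI order_trans)
  ultimately have "C = {x. \<forall>a\<in>n ` F. a \<bullet> x \<le> 0}"
    by auto
  with F(1) show thesis
    using that by blast
qed

lemma polyhedral_cone_closed: "polyhedral_cone C \<Longrightarrow> closed C"
  by (simp add: polyhedral_cone_def polyhedron_imp_closed)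

lemma polyhedral_cone_convex: "polyhedral_cone C \<Longrightarrow> convex C"
  by (simp add: polyhedral_cone_def polyhedron_imp_convex)

lemma polyhedral_cone_0: "polyhedral_cone C \<Longrightarrow> 0 \<in> C"
  by (simp add: polyhedral_cone_def convex_cone_contains_0)

lemma polyhedral_cone_Int:
  "polyhedral_cone C \<Longrightarrow> polyhedral_cone D \<Longrightarrow> polyhedral_cone (C \<inter> D)"
  using convex_cone_Inter[of "{C, D}"] by (auto simp: polyhedral_cone_def)

lemma polyhedral_cone_subspace: "subspace S \<Longrightarrow> polyhedral_cone S"
  by (simp add: polyhedral_cone_def subspace_imp_convex_cone affine_imp_polyhedron subspace_imp_affine)

lemma polyhedral_cone_halfspace:
  "polyhedral_cone {x. a \<bullet> x \<le> 0}" "polyhedral_cone {x. a \<bullet> x \<ge> 0}" "polyhedral_cone {x. a \<bullet> x = 0}"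
  by (simp_all add: polyhedral_cone_def polyhedron_halfspace_le polyhedron_halfspace_ge
      polyhedron_hyperplane convex_cone_halfspace_le convex_cone_halfspace_ge
      subspace_imp_convex_cone subspace_hyperplane)

lemma convex_cone_inner_le_0_hull:
  assumes "\<And>s. s \<in> S \<Longrightarrow> a \<bullet> s \<le> 0" "x \<in> convex_cone hull S"
  shows "a \<bullet> x \<le> 0"
proof -
  have "convex_cone hull S \<subseteq> {x. a \<bullet> x \<le> 0}"
    using assms(1) by (intro hull_minimal) (auto simp: convex_cone_halfspace_le)
  with assms(2) show ?thesis
    by blast
qed

text \<open>
  Weyl's half of the Minkowski--Weyl theorem (finitely generated cones are polyhedral) gives the
  other half by duality. If \<open>C\<close> is cut out by the normals \<open>A\<close>, then the cone generated by \<open>A\<close> is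
  cut out by the normals in some finite set \<open>B\<close>, and \<open>B\<close> generates \<open>C\<close>: a normal \<open>e\<close> that separates
  a point \<open>x\<close> of \<open>C\<close> from the cone of \<open>B\<close> is nonpositive on \<open>B\<close>, hence lies in the cone of \<open>A\<close>, so
  \<open>e\<close> is nonpositive at \<open>x\<close> after all.
\<close>
lemma polyhedral_cone_generatorsE:
  fixes C :: "'a::euclidean_space set"
  assumes "polyhedral_cone C"
  obtains S where "finite S" "C = convex_cone hull S"
proof -
  obtain A where A: "finite A" "C = {x. \<forall>a\<in>A. a \<bullet> x \<le> 0}"
    using assms by (rule polyhedral_cone_halfspacesE)
  have pc: "polyhedral_cone (convex_cone hull A)"
    by (simp add: A(1) convex_cone_convex_cone_hull polyhedral_cone_def polyhedron_convex_cone_hull)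
  obtain B where B: "finite B" "convex_cone hull A = {x. \<forall>b\<in>B. b \<bullet> x \<le> 0}"
    using pc by (rule polyhedral_cone_halfspacesE)
  let ?D = "convex_cone hull B"
  have pD: "polyhedral_cone ?D"
    by (simp add: B(1) convex_cone_convex_cone_hull polyhedral_cone_def polyhedron_convex_cone_hull)
  have "b \<in> C" if "b \<in> B" for b
    unfolding A(2) using B(2) hull_inc[of _ A convex_cone] that by (auto simp: inner_commute)
  then have "?D \<subseteq> C"
    by (intro hull_minimal) (use assms polyhedral_cone_def in auto)
  moreover have "x \<in> ?D" if "x \<in> C" for x
  proof (rule ccontr)
    assume "x \<notin> ?D"
    obtain E where E: "finite E" "?D = {x. \<forall>e\<in>E. e \<bullet> x \<le> 0}"
      using pD by (rule polyhedral_cone_halfspacesE)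
    with \<open>x \<notin> ?D\<close> obtain e where e: "e \<in> E" "e \<bullet> x > 0"
      by force
    have "e \<bullet> b \<le> 0" if "b \<in> B" for b
      using E(2) e(1) hull_inc[OF that, of convex_cone] by blast
    then have "e \<in> convex_cone hull A"
      unfolding B(2) by (simp add: inner_commute)
    moreover have "x \<bullet> a \<le> 0" if "a \<in> A" for a
      using \<open>x \<in> C\<close> that unfolding A(2) by (simp add: inner_commute)
    ultimately have "x \<bullet> e \<le> 0"
      using convex_cone_inner_le_0_hull by blast
    with e(2) show False
      by (simp add: inner_commute)
  qed
  ultimately have "C = ?D"
    by blast
  with B(1) show thesis
    using that by blast
qed

lemma polyhedral_cone_sums:
  fixes C D :: "'a::euclidean_space set"
  assumes "polyhedral_cone C" "polyhedral_cone D"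
  shows "polyhedral_cone {x + y |x y. x \<in> C \<and> y \<in> D}"
proof -
  obtain S where S: "finite S" "C = convex_cone hull S"
    using assms(1) by (rule polyhedral_cone_generatorsE)
  obtain T where T: "finite T" "D = convex_cone hull T"
    using assms(2) by (rule polyhedral_cone_generatorsE)
  have "{x + y |x y. x \<in> C \<and> y \<in> D} = convex_cone hull (S \<union> T)"
    unfolding S(2) T(2) convex_cone_hull_Un by blast
  then show ?thesis
    by (simp add: S(1) T(1) convex_cone_convex_cone_hull polyhedral_cone_def
        polyhedron_convex_cone_hull)
qed

lemma face_of_cone_0:
  assumes "convex_cone C" "F face_of C" "F \<noteq> {}"
  shows "0 \<in> F"
proof -
  obtain y where y: "y \<in> F"
    using assms(3) by blast
  show ?thesis
  proof (cases "y = 0")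
    case False
    have "y \<in> C"
      using assms(2) y face_of_imp_subset by blast
    then have "2 *\<^sub>R y \<in> C" "0 \<in> C"
      using assms(1) by (auto intro: convex_cone_scaleR convex_cone_contains_0)
    moreover have "y \<in> open_segment 0 (2 *\<^sub>R y)"
      using False unfolding in_segment by (auto intro!: exI[of _ "1/2"])
    ultimately show ?thesis
      using assms(2) y unfolding face_of_def by blast
  qed (use y in simp)
qed

lemma polyhedral_cone_face:
  assumes "polyhedral_cone C" "F face_of C" "F \<noteq> {}"
  shows "polyhedral_cone F"
proof -
  have "convex_cone C" "polyhedron C"
    using assms(1) by (auto simp: polyhedral_cone_def)
  then have pF: "polyhedron F"
    using assms(2) face_of_polyhedron_polyhedron by blast
  have F: "F = (affine hull F) \<inter> C"
    using \<open>polyhedron C\<close> assms(2) face_of_imp_eq_affine_Int polyhedron_imp_convex by blast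
  have "0 \<in> F"
    using \<open>convex_cone C\<close> assms face_of_cone_0 by blast
  then have "affine hull F = span F"
    by (simp add: affine_hull_span_0 hull_inc)
  with F have "F = span F \<inter> C"
    by simp
  then show ?thesis
    using polyhedral_cone_Int[OF polyhedral_cone_subspace assms(1), of "span F"] by simp
qed

lemma normal_cone_at_face:
  assumes "0 \<in> F" "F \<subseteq> C"
  shows "normal_cone_at F C = {c. (\<forall>x\<in>C. c \<bullet> x \<le> 0) \<and> (\<forall>y\<in>F. c \<bullet> y = 0)}" (is "_ = ?R")
proof -
  have "c \<in> ?R" if c: "\<forall>x\<in>C. \<forall>y\<in>F. c \<bullet> x \<le> c \<bullet> y" for c
  proof -
    have "c \<bullet> x \<le> 0" if "x \<in> C" for x
      using c that assms(1) by fastforce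
    moreover have "c \<bullet> y \<ge> 0" if "y \<in> F" for y
      using c that assms by fastforce
    ultimately show ?thesis
      using assms(2) by force
  qed
  moreover have "c \<bullet> x \<le> c \<bullet> y" if "c \<in> ?R" "x \<in> C" "y \<in> F" for c x y
    using that by simp
  ultimately show ?thesis
    unfolding normal_cone_at_def by blast
qed

lemma polyhedral_cone_normal_cone_at:
  assumes "polyhedral_cone C" "F face_of C" "F \<noteq> {}"
  shows "polyhedral_cone (normal_cone_at F C)"
proof -
  have F0: "0 \<in> F" "F \<subseteq> C"
    using assms face_of_cone_0[of C F] face_of_imp_subset[of F C] by (auto simp: polyhedral_cone_def)
  obtain S where S: "finite S" "C = convex_cone hull S"
    using assms(1) by (rule polyhedral_cone_generatorsE)
  obtain T where T: "finite T" "F = convex_cone hull T"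
    using polyhedral_cone_face[OF assms] by (rule polyhedral_cone_generatorsE)
  have "c \<in> normal_cone_at F C \<longleftrightarrow> (\<forall>a\<in>S \<union> uminus ` T. a \<bullet> c \<le> 0)" for c
  proof
    assume "c \<in> normal_cone_at F C"
    then have c: "\<forall>x\<in>C. c \<bullet> x \<le> 0" "\<forall>y\<in>F. c \<bullet> y = 0"
      unfolding normal_cone_at_face[OF F0] by auto
    moreover have "S \<subseteq> C" "T \<subseteq> F"
      using S(2) T(2) by (auto simp: hull_inc)
    ultimately show "\<forall>a\<in>S \<union> uminus ` T. a \<bullet> c \<le> 0"
      by (force simp: inner_commute)
  next
    assume c: "\<forall>a\<in>S \<union> uminus ` T. a \<bullet> c \<le> 0"
    have "c \<bullet> x \<le> 0" if "x \<in> C" for x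
      using convex_cone_inner_le_0_hull[of S c x] c that S(2) by (auto simp: inner_commute)
    moreover have "c \<bullet> y = 0" if "y \<in> F" for y
    proof -
      have "- c \<bullet> t \<le> 0" if "t \<in> T" for t
      proof -
        have "- t \<bullet> c \<le> 0"
          using c that by blast
        then show ?thesis
          by (simp add: inner_commute)
      qed
      then have "- c \<bullet> y \<le> 0"
        using convex_cone_inner_le_0_hull[of T "-c" y] \<open>y \<in> F\<close> T(2) by blast
      moreover have "c \<bullet> y \<le> 0"
        using \<open>\<And>x. x \<in> C \<Longrightarrow> c \<bullet> x \<le> 0\<close> F0(2) that by blast
      ultimately show ?thesis
        by simp
    qed
    ultimately show "c \<in> normal_cone_at F C"
      unfolding normal_cone_at_face[OF F0] by blast
  qed
  then have "normal_cone_at F C = {c. \<forall>a\<in>S \<union> uminus ` T. a \<bullet> c \<le> 0}"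
    by blast
  then show ?thesis
    using polyhedral_cone_halfspaces[of "S \<union> uminus ` T"] S(1) T(1) by simp
qed

text \<open>
  This puts \<open>V_cone k C\<close> into the domain of \<open>rho\<close>. Generators are needed because a sum of cones
  has no evident description by halfspaces.
\<close>
lemma polyhedral_cone_Pi_cone:
  "polyhedral_cone C \<Longrightarrow> F face_of C \<Longrightarrow> F \<noteq> {} \<Longrightarrow> polyhedral_cone (Pi_cone F C)"
  unfolding Pi_cone_def
  using polyhedral_cone_sums polyhedral_cone_face polyhedral_cone_normal_cone_at by blast

lemma finite_faces_of_dim: "polyhedral_cone C \<Longrightarrow> finite (faces_of_dim k C)"
  unfolding faces_of_dim_def polyhedral_cone_def
  by (rule finite_subset[OF _ finite_polyhedron_faces]) auto

lemma cone_functions_sum: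
  "(\<And>i. i \<in> I \<Longrightarrow> f i \<in> cone_functions) \<Longrightarrow> sum f I \<in> cone_functions"
proof (induction I rule: infinite_finite_induct)
  case (infinite A)
  show ?case unfolding sum.infinite[OF infinite(1)] by (rule zero_in_cone_functions)
next
  case empty
  show ?case unfolding sum.empty by (rule zero_in_cone_functions)
next
  case (insert i I)
  show ?case unfolding sum.insert[OF insert(1,2)] by (intro cone_functions_add insert.IH insert.prems) auto
qed

lemma indicator_cone_functions: "polyhedral_cone C \<Longrightarrow> indicator C \<in> cone_functions"
  unfolding cone_functions_def by (rule group_closure.base) auto

lemma V_cone_cone_functions:
  assumes "polyhedral_cone C"
  shows "V_cone k C \<in> cone_functions"
  unfolding V_cone_def
proof (rule cone_functions_sum)
  fix F
  assume "F \<in> faces_of_dim k C"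
  then have "polyhedral_cone (Pi_cone F C)"
    using assms by (auto simp: faces_of_dim_def intro: polyhedral_cone_Pi_cone)
  then show "indicator (Pi_cone F C) \<in> cone_functions"
    by (rule indicator_cone_functions)
qed

section \<open>Generic points\<close>

text \<open>
  A property holds eventually along this filter if it holds off finitely many linear hyperplanes.
  As a filter it is closed under finite conjunctions, so exceptional hyperplanes never need to be
  collected by hand.
\<close>
definition generic :: "'a::euclidean_space filter" where
  "generic = (INF w\<in>-{0}. principal {x. w \<bullet> x \<noteq> 0})"

lemma eventually_generic:
  "eventually P generic \<longleftrightarrow>
    (\<exists>W. finite W \<and> 0 \<notin> W \<and> (\<forall>x. (\<forall>w\<in>W. w \<bullet> x \<noteq> 0) \<longrightarrow> P x))"
proof -
  have "eventually P (INF w\<in>W. principal {x. w \<bullet> x \<noteq> 0}) \<longleftrightarrow>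
      (\<forall>x. (\<forall>w\<in>W. w \<bullet> x \<noteq> 0) \<longrightarrow> P x)" if "finite W" for W
    using that by (auto simp: INF_principal_finite eventually_principal)
  then have "(\<exists>W\<subseteq>-{0}. finite W \<and> eventually P (INF w\<in>W. principal {x. w \<bullet> x \<noteq> 0})) \<longleftrightarrow>
      (\<exists>W\<subseteq>-{0}. finite W \<and> (\<forall>x. (\<forall>w\<in>W. w \<bullet> x \<noteq> 0) \<longrightarrow> P x))"
    by (intro ex_cong1 conj_cong) auto
  also have "\<dots> \<longleftrightarrow> (\<exists>W. finite W \<and> 0 \<notin> W \<and> (\<forall>x. (\<forall>w\<in>W. w \<bullet> x \<noteq> 0) \<longrightarrow> P x))"
    unfolding subset_Compl_singleton by (intro ex_cong1) blast
  finally show ?thesis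
    unfolding generic_def by (subst eventually_INF)
qed

lemma generic_not_hyperplane: "w \<noteq> 0 \<Longrightarrow> \<forall>\<^sub>F x in generic. w \<bullet> x \<noteq> 0"
  unfolding eventually_generic by (rule exI[of _ "{w}"]) auto

text \<open>
  A point \<open>x\<close> for which some residual \<open>x - u\<close> is orthogonal to \<open>W\<close> lies in the sum of \<open>U\<close> and the
  orthogonal complement of \<open>W\<close>. As \<open>U\<close> is smaller than \<open>W\<close>, this sum lies in the hyperplane
  orthogonal to any nonzero vector of \<open>W\<close> that is orthogonal to \<open>U\<close>.
\<close>
lemma generic_residual_not_orthogonal:
  fixes U W :: "'a::euclidean_space set"
  assumes "subspace U" "subspace W" "U \<subset> W"
  shows "\<forall>\<^sub>F x in generic. \<forall>u\<in>U. \<exists>w\<in>W. (x - u) \<bullet> w \<noteq> 0"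
proof -
  have "span U \<subset> span W"
    using assms by (simp add: span_eq_iff[THEN iffD2])
  then obtain w where w: "w \<noteq> 0" "w \<in> span W" "\<And>y. y \<in> span U \<Longrightarrow> orthogonal w y"
    using orthogonal_to_subspace_exists_gen by blast
  have "w \<in> W"
    using w(2) assms(2) by (simp add: span_eq_iff[THEN iffD2])
  have "w \<bullet> u = 0" if "u \<in> U" for u
    using w(3) that by (simp add: orthogonal_def span_base)
  then have "(x - u) \<bullet> w = w \<bullet> x" if "u \<in> U" for x u
    using that by (simp add: inner_commute[of "x - u"] inner_diff_right)
  then show ?thesis
    using generic_not_hyperplane[OF w(1)] \<open>w \<in> W\<close>
    by (auto elim!: eventually_mono intro!: bexI[of _ w])
qed

lemma cone_functions_diff:
  "f \<in> cone_functions \<Longrightarrow> g \<in> cone_functions \<Longrightarrow> f - g \<in> cone_functions"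
  unfolding cone_functions_def by (rule group_closure.diff)

lemma lower_cone_functions_subset: "lower_cone_functions \<subseteq> cone_functions"
proof
  fix f :: "'a \<Rightarrow> int"
  assume "f \<in> lower_cone_functions"
  then show "f \<in> cone_functions"
    unfolding lower_cone_functions_def cone_functions_def
  proof induction
    case (base s)
    then show ?case
      by (intro group_closure.base) auto
  qed (rule group_closure.diff)
qed

lemma cone_functions_mult_hyperplane:
  assumes "f \<in> cone_functions" "w \<noteq> 0"
  shows "(\<lambda>x. f x * indicator {x. w \<bullet> x = 0} x) \<in> lower_cone_functions"
  using assms(1) unfolding cone_functions_def
proof induction
  case (base s)
  let ?H = "{x. w \<bullet> x = 0}"
  show ?case
  proof (cases "s = 0")
    case True
    then have "(\<lambda>x. s x * indicator ?H x) = 0"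
      by (auto simp: fun_eq_iff)
    then show ?thesis
      unfolding lower_cone_functions_def by (simp only: zero_in_group_closure)
  next
    case False
    then obtain C where C: "s = indicator C" "polyhedral_cone C"
      using base by blast
    have eq: "(\<lambda>x. s x * indicator ?H x) = indicator (C \<inter> ?H)"
      by (auto simp: C(1) indicator_def fun_eq_iff)
    have "polyhedral_cone (C \<inter> ?H)"
      using C(2) by (simp add: polyhedral_cone_Int polyhedral_cone_halfspace)
    moreover have "aff_dim (C \<inter> ?H) < int DIM('a)"
      using aff_dim_subset[of "C \<inter> ?H" ?H] aff_dim_hyperplane[OF assms(2), of 0] by auto
    ultimately show ?thesis
      unfolding eq lower_cone_functions_def by (blast intro: group_closure.base)
  qed
next
  case (diff s t)
  have "(\<lambda>x. (s - t) x * indicator {x. w \<bullet> x = 0} x) =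
      (\<lambda>x. s x * indicator {x. w \<bullet> x = 0} x) - (\<lambda>x. t x * indicator {x. w \<bullet> x = 0} x)"
    by (auto simp: fun_eq_iff left_diff_distrib)
  with diff.IH show ?case
    by (simp add: lower_cone_functions_def group_closure.diff)
qed

text \<open>
  The functions to be compared need not be given by matching lists of cones, so cancellation is
  arranged by multiplication: for an exceptional hyperplane \<open>H\<close>, the function \<open>f \<cdot> [H]\<close> is spanned
  by the lower dimensional cones \<open>C \<inter> H\<close>, and \<open>f - f \<cdot> [H]\<close> is again spanned by cones and
  has one exceptional hyperplane fewer.
\<close>
lemma lower_cone_functions_if_generically_zero:
  assumes "f \<in> cone_functions" "\<forall>\<^sub>F x in generic. f x = 0"
  shows "f \<in> lower_cone_functions"
proof -
  obtain W where W: "finite W" "0 \<notin> W" "\<And>x. (\<forall>w\<in>W. w \<bullet> x \<noteq> 0) \<Longrightarrow> f x = 0"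
    using assms(2) unfolding eventually_generic by blast
  then show ?thesis
    using assms(1)
  proof (induction W arbitrary: f)
    case empty
    then have "f = 0"
      by (auto simp: fun_eq_iff)
    then show ?case
      unfolding lower_cone_functions_def by (simp only: zero_in_group_closure)
  next
    case (insert w W)
    define g where "g = (\<lambda>x. f x * indicator {x. w \<bullet> x = 0} x)"
    have g: "g \<in> lower_cone_functions"
      unfolding g_def using insert.prems by (intro cone_functions_mult_hyperplane) auto
    have "f - g \<in> lower_cone_functions"
    proof (rule insert.IH)
      show "(f - g) x = 0" if "\<forall>w\<in>W. w \<bullet> x \<noteq> 0" for x
        using insert.prems(2)[of x] that by (auto simp: g_def indicator_def)
      show "f - g \<in> cone_functions"
        using g lower_cone_functions_subset insert.prems(3) by (blast intro: cone_functions_diff)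
    qed (use insert.prems in auto)
    with g have "(f - g) + g \<in> lower_cone_functions"
      by (intro lower_cone_functions_add)
    then show ?case
      by simp
  qed
qed

lemma rho_eq_if_generically_eq:
  assumes "f \<in> cone_functions" "g \<in> cone_functions" "\<forall>\<^sub>F x in generic. f x = g x"
  shows "rho f = rho g"
proof -
  have "f - g \<in> lower_cone_functions"
    using assms(3) by (intro lower_cone_functions_if_generically_zero cone_functions_diff assms(1,2))
      (auto elim!: eventually_mono)
  then have "simple_rel f g"
    using assms(1,2) by (simp add: simple_rel_def)
  then show ?thesis
    using Quotient3_rel_abs[OF Quotient3_simple] by blast
qed

section \<open>Nearest points and the faces that contain them\<close>

text \<open>
  The intersection of all faces through \<open>p\<close> is such a face: otherwise \<open>p\<close> would lie in one of its
  facets, which is a strictly smaller face through \<open>p\<close>.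
\<close>
lemma exists_face_with_rel_interior:
  fixes C :: "'a::euclidean_space set"
  assumes "polyhedron C" "p \<in> C"
  obtains F where "F face_of C" "p \<in> rel_interior F"
proof -
  define F where "F = \<Inter>{G. G face_of C \<and> p \<in> G}"
  have C: "C \<in> {G. G face_of C \<and> p \<in> G}"
    using assms by (simp add: face_of_refl polyhedron_imp_convex)
  then have F: "F face_of C"
    unfolding F_def by (intro face_of_Inter) auto
  have p: "p \<in> F"
    unfolding F_def by auto
  have pF: "polyhedron F"
    using F assms(1) face_of_polyhedron_polyhedron by blast
  have "p \<in> rel_interior F"
  proof (rule ccontr)
    assume "p \<notin> rel_interior F"
    then obtain G where G: "G facet_of F" "p \<in> G"
      using p rel_interior_of_polyhedron[OF pF] by blast
    then have "G face_of C"
      using F facet_of_imp_face_of face_of_trans by blast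
    then have "F \<subseteq> G"
      using G(2) unfolding F_def by blast
    then have "G = F"
      using G(1) facet_of_imp_subset by blast
    then show False
      using G(1) by (simp add: facet_of_def)
  qed
  with F show thesis
    using that by blast
qed

text \<open>
  The relatively open faces of \<open>C\<close> partition \<open>C\<close>; this is the union of those of dimension \<open>k\<close>.
\<close>
definition open_skeleton :: "nat \<Rightarrow> 'a::euclidean_space set \<Rightarrow> 'a set" where
  "open_skeleton k C = (\<Union>F\<in>faces_of_dim k C. rel_interior F)"

lemma open_skeleton_iff:
  assumes "F face_of C" "p \<in> rel_interior F"
  shows "p \<in> open_skeleton k C \<longleftrightarrow> aff_dim F = int k"
proof
  assume "p \<in> open_skeleton k C"
  then obtain G where G: "G face_of C" "aff_dim G = int k" "p \<in> rel_interior G"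
    unfolding open_skeleton_def faces_of_dim_def by blast
  then have "F = G"
    using face_of_eq assms by blast
  with G(2) show "aff_dim F = int k"
    by simp
next
  assume "aff_dim F = int k"
  then have "F \<in> faces_of_dim k C"
    using assms rel_interior_subset unfolding faces_of_dim_def by blast
  then show "p \<in> open_skeleton k C"
    using assms(2) unfolding open_skeleton_def by blast
qed

lemma open_skeleton_face:
  assumes "polyhedron C" "D face_of C" "p \<in> D"
  shows "p \<in> open_skeleton k C \<longleftrightarrow> p \<in> open_skeleton k D"
proof -
  obtain F where F: "F face_of D" "p \<in> rel_interior F"
    using exists_face_with_rel_interior assms face_of_polyhedron_polyhedron by metis
  then have "F face_of C"
    using assms(2) face_of_trans by blast
  then show ?thesis
    using F open_skeleton_iff by metis
qed

text \<open>
  In the interior of the halfspace nothing is cut off: the face \<open>F\<close> of \<open>C\<close> through \<open>p\<close> turns into the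
  face \<open>F \<inter> {y. a \<bullet> y \<ge> 0}\<close>, which still has \<open>p\<close> in its relative interior and has the same dimension.
\<close>
lemma open_skeleton_Int_halfspace:
  fixes C :: "'a::euclidean_space set"
  assumes "polyhedron C" "p \<in> C" "a \<bullet> p > 0"
  shows "p \<in> open_skeleton k (C \<inter> {y. a \<bullet> y \<ge> 0}) \<longleftrightarrow> p \<in> open_skeleton k C"
proof -
  let ?H = "{y. a \<bullet> y \<ge> 0}"
  let ?O = "{y. 0 < a \<bullet> y}"
  obtain F where F: "F face_of C" "p \<in> rel_interior F"
    using exists_face_with_rel_interior assms by blast
  have convF: "convex F"
    using F(1) face_of_imp_convex by blast
  have face: "F \<inter> ?H face_of C \<inter> ?H"
    using F(1) by (intro face_of_slice convex_halfspace_ge)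
  have "?O \<subseteq> interior ?H"
    by (rule interior_maximal) (auto simp: open_halfspace_gt)
  then have "?O \<subseteq> rel_interior ?H"
    using interior_subset_rel_interior by blast
  then have "p \<in> rel_interior F \<inter> rel_interior ?H"
    using assms(3) F(2) by blast
  then have relint: "p \<in> rel_interior (F \<inter> ?H)"
    using convex_rel_interior_inter_two[OF convF, of ?H] convex_halfspace_ge by blast
  have "p \<in> F \<inter> ?O"
    using F(2) rel_interior_subset assms(3) by blast
  then have "aff_dim (F \<inter> ?O) = aff_dim F"
    using convF open_halfspace_gt[of 0 a] by (intro aff_dim_convex_Int_open) auto
  moreover have "aff_dim (F \<inter> ?O) \<le> aff_dim (F \<inter> ?H)" "aff_dim (F \<inter> ?H) \<le> aff_dim F"
    by (auto intro!: aff_dim_subset)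
  ultimately have "aff_dim (F \<inter> ?H) = aff_dim F"
    by simp
  then show ?thesis
    using open_skeleton_iff[OF F] open_skeleton_iff[OF face relint] by simp
qed

text \<open>
  The two left-hand sides add up to the squared distance of \<open>p\<close> and \<open>q\<close>.
\<close>
lemma variational_inequalities_eq:
  fixes p q x :: "'a::real_inner"
  assumes "(x - p) \<bullet> (q - p) \<le> 0" "(x - q) \<bullet> (p - q) \<le> 0"
  shows "p = q"
proof -
  have "(x - p) \<bullet> (q - p) + (x - q) \<bullet> (p - q) = (p - q) \<bullet> (p - q)"
    by (simp add: inner_diff_left inner_diff_right)
  with assms have "(p - q) \<bullet> (p - q) \<le> 0"
    by linarith
  then show ?thesis
    using inner_ge_zero[of "p - q"] inner_eq_zero_iff[of "p - q"] by simp
qed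

lemma closest_point_polyhedral_cone:
  assumes "polyhedral_cone C"
  shows "closest_point C x \<in> C"
    and "y \<in> C \<Longrightarrow> (x - closest_point C x) \<bullet> (y - closest_point C x) \<le> 0"
proof -
  have C: "closed C" "convex C" "C \<noteq> {}"
    using assms polyhedral_cone_closed polyhedral_cone_convex polyhedral_cone_0 by blast+
  then show "closest_point C x \<in> C"
    by (intro closest_point_exists(1))
  show "y \<in> C \<Longrightarrow> (x - closest_point C x) \<bullet> (y - closest_point C x) \<le> 0"
    using C by (intro closest_point_dot)
qed

lemma closest_point_eqI:
  assumes "polyhedral_cone C" "q \<in> C" "\<And>y. y \<in> C \<Longrightarrow> (x - q) \<bullet> (y - q) \<le> 0"
  shows "closest_point C x = q"
proof (rule variational_inequalities_eq)
  show "(x - closest_point C x) \<bullet> (q - closest_point C x) \<le> 0"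
    using assms(1,2) by (rule closest_point_polyhedral_cone)
  show "(x - q) \<bullet> (closest_point C x - q) \<le> 0"
    using assms(1,3) closest_point_polyhedral_cone(1) by metis
qed

lemma closest_point_subset_eq:
  assumes "polyhedral_cone C" "polyhedral_cone D" "D \<subseteq> C" "closest_point C x \<in> D"
  shows "closest_point D x = closest_point C x"
  using assms(2,4)
proof (rule closest_point_eqI)
  fix y
  assume "y \<in> D"
  then show "(x - closest_point C x) \<bullet> (y - closest_point C x) \<le> 0"
    using assms(1,3) by (intro closest_point_polyhedral_cone(2)) auto
qed

text \<open>
  If \<open>x = f + c\<close> with \<open>f \<in> F\<close> and \<open>c\<close> in the normal cone, then \<open>c = x - f\<close> satisfies the variational
  inequality that characterises \<open>f\<close> as the point of \<open>C\<close> nearest to \<open>x\<close>.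
\<close>
lemma mem_Pi_cone_iff:
  fixes x :: "'a::euclidean_space"
  assumes C: "polyhedral_cone C" and F: "F face_of C" "F \<noteq> {}"
  defines "p \<equiv> closest_point C x"
  shows "x \<in> Pi_cone F C \<longleftrightarrow> p \<in> F \<and> (\<forall>y\<in>F. (x - p) \<bullet> y = 0)"
proof -
  have F0: "0 \<in> F" "F \<subseteq> C"
    using assms face_of_cone_0[of C F] face_of_imp_subset[of F C] by (auto simp: polyhedral_cone_def)
  show ?thesis
  proof
    assume "x \<in> Pi_cone F C"
    then obtain f c where fc: "x = f + c" "f \<in> F" "\<And>y. y \<in> C \<Longrightarrow> c \<bullet> y \<le> 0"
      "\<And>y. y \<in> F \<Longrightarrow> c \<bullet> y = 0"
      unfolding Pi_cone_def normal_cone_at_face[OF F0] by blast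
    have "p = f"
      unfolding p_def
      using C by (rule closest_point_eqI) (use fc F0 in \<open>auto simp: inner_diff_right\<close>)
    then show "p \<in> F \<and> (\<forall>y\<in>F. (x - p) \<bullet> y = 0)"
      using fc by auto
  next
    assume p: "p \<in> F \<and> (\<forall>y\<in>F. (x - p) \<bullet> y = 0)"
    have "(x - p) \<bullet> y \<le> 0" if "y \<in> C" for y
    proof -
      have "(x - p) \<bullet> (y - p) \<le> 0"
        unfolding p_def using C that by (rule closest_point_polyhedral_cone(2))
      moreover have "(x - p) \<bullet> p = 0"
        using p by blast
      ultimately show ?thesis
        by (simp add: inner_diff_right)
    qed
    then have "x - p \<in> normal_cone_at F C"
      unfolding normal_cone_at_face[OF F0] using p by blast
    moreover have "x = p + (x - p)"
      by simp
    ultimately show "x \<in> Pi_cone F C"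
      unfolding Pi_cone_def using p by blast
  qed
qed

text \<open>
  The linear functional \<open>x - p\<close> is maximal on \<open>C\<close> at the nearest point \<open>p\<close>; being maximal at a relative
  interior point of \<open>F\<close>, it is constant on \<open>F\<close>, and \<open>0 \<in> F\<close>.
\<close>
lemma residual_orthogonal_face:
  assumes C: "polyhedral_cone C" and F: "F face_of C" "closest_point C x \<in> rel_interior F"
    and y: "y \<in> F"
  shows "(x - closest_point C x) \<bullet> y = 0"
proof -
  define p where "p = closest_point C x"
  have "F \<noteq> {}" "F \<subseteq> C" "convex F"
    using y F(1) face_of_imp_subset face_of_imp_convex by blast+
  then have 0: "0 \<in> F"
    using C F(1) face_of_cone_0 by (auto simp: polyhedral_cone_def)
  have le: "(x - p) \<bullet> (z - p) \<le> 0" if "z \<in> F" for z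
    unfolding p_def using C that \<open>F \<subseteq> C\<close> by (blast intro: closest_point_polyhedral_cone(2))
  have "p \<in> rel_interior F"
    using F(2) by (simp add: p_def)
  \<comment> \<open>Segments in \<open>F\<close> that end at \<open>p\<close> can be prolonged within \<open>F\<close>, which reverses the inequality.\<close>
  then have prolong: "\<forall>z\<in>F. \<exists>e>1. (1 - e) *\<^sub>R z + e *\<^sub>R p \<in> F"
    by (simp add: convex_rel_interior_iff[OF \<open>convex F\<close> \<open>F \<noteq> {}\<close>])
  have eq: "(x - p) \<bullet> (z - p) = 0" if z: "z \<in> F" for z
  proof -
    obtain e where e: "e > 1" "(1 - e) *\<^sub>R z + e *\<^sub>R p \<in> F"
      using prolong z by blast
    have "(1 - e) *\<^sub>R z + e *\<^sub>R p - p = (1 - e) *\<^sub>R (z - p)"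
      by (simp add: algebra_simps)
    then have "(1 - e) * ((x - p) \<bullet> (z - p)) \<le> 0"
      using le[OF e(2)] by simp
    then have "(x - p) \<bullet> (z - p) \<ge> 0"
      using e(1) by (simp add: mult_le_0_iff)
    with le[OF z] show ?thesis
      by simp
  qed
  show ?thesis
    using eq[OF y] eq[OF 0] unfolding p_def by (simp add: inner_diff_right)
qed

text \<open>
  The form in which genericity is used below: to show that a nearest point avoids \<open>U\<close>, it is enough to
  know that its residual is orthogonal to a face that spans more than \<open>U\<close>.
\<close>
lemma generic_closest_point_not_in:
  assumes C: "polyhedral_cone C" and F: "F face_of C" and U: "subspace U" "U \<subset> span F"
  shows "\<forall>\<^sub>F x in generic. closest_point C x \<in> U \<longrightarrow> (\<exists>y\<in>F. (x - closest_point C x) \<bullet> y \<noteq> 0)"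
  using generic_residual_not_orthogonal[OF U(1) subspace_span U(2)]
proof (rule eventually_mono, intro impI)
  fix x
  assume *: "\<forall>u\<in>U. \<exists>w\<in>span F. (x - u) \<bullet> w \<noteq> 0" and "closest_point C x \<in> U"
  then obtain w where w: "w \<in> span F" "(x - closest_point C x) \<bullet> w \<noteq> 0"
    by blast
  show "\<exists>y\<in>F. (x - closest_point C x) \<bullet> y \<noteq> 0"
  proof (rule ccontr)
    assume "\<not> ?thesis"
    then have "F \<subseteq> {y. (x - closest_point C x) \<bullet> y = 0}"
      by blast
    then have "span F \<subseteq> {y. (x - closest_point C x) \<bullet> y = 0}"
      by (intro span_minimal subspace_hyperplane)
    with w show False
      by blast
  qed
qed

lemma span_proper_face:
  assumes "polyhedral_cone C" "F face_of C" "G face_of C" "G \<noteq> {}" "G \<subset> F"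
  shows "span G \<subset> span F"
proof -
  have "G face_of F"
    using assms face_of_imp_subset face_of_subset by (metis psubset_imp_subset)
  have "convex F"
    using assms(2) face_of_imp_convex by blast
  then have lt: "aff_dim G < aff_dim F"
    using face_of_aff_dim_lt[OF _ \<open>G face_of F\<close>] assms(5) by blast
  have "0 \<in> G" "0 \<in> F"
    using assms face_of_cone_0[of C G] by (auto simp: polyhedral_cone_def)
  then have "dim G < dim F"
    using lt by (simp add: aff_dim_zero hull_inc)
  moreover have "span G \<subseteq> span F"
    using assms(5) by (intro span_mono) auto
  ultimately show ?thesis
    by (metis dim_span less_irrefl psubsetI)
qed

lemma finite_faces: "polyhedral_cone C \<Longrightarrow> finite {F. F face_of C}"
  by (simp add: polyhedral_cone_def finite_polyhedron_faces)

text \<open>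
  By \<open>mem_Pi_cone_iff\<close> and \<open>residual_orthogonal_face\<close>, the only way for \<open>x\<close> to lie in \<open>Pi_cone F C\<close>
  although the nearest point \<open>p\<close> is not in the relative interior of \<open>F\<close> is that \<open>p\<close> lies in a smaller
  face \<open>G\<close> while \<open>x - p\<close> is orthogonal to \<open>F\<close>. As \<open>span G\<close> is smaller than \<open>span F\<close>, a generic
  point \<open>x\<close> avoids this.
\<close>
lemma generic_mem_Pi_cone_iff:
  assumes C: "polyhedral_cone C"
  shows "\<forall>\<^sub>F x in generic. \<forall>F. F face_of C \<and> F \<noteq> {} \<longrightarrow>
    (x \<in> Pi_cone F C \<longleftrightarrow> closest_point C x \<in> rel_interior F)"
proof -
  define \<F> where "\<F> = {F. F face_of C}"
  have fin: "finite \<F>"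
    unfolding \<F>_def using C by (rule finite_faces)
  have "\<forall>\<^sub>F x in generic. \<forall>F\<in>\<F>. \<forall>G\<in>\<F>. G \<noteq> {} \<and> G \<subset> F \<longrightarrow>
      closest_point C x \<in> span G \<longrightarrow> (\<exists>y\<in>F. (x - closest_point C x) \<bullet> y \<noteq> 0)"
  proof (intro eventually_ball_finite fin ballI)
    fix F G
    assume "F \<in> \<F>" "G \<in> \<F>"
    then have FG: "F face_of C" "G face_of C"
      by (auto simp: \<F>_def)
    show "\<forall>\<^sub>F x in generic. G \<noteq> {} \<and> G \<subset> F \<longrightarrow>
      closest_point C x \<in> span G \<longrightarrow> (\<exists>y\<in>F. (x - closest_point C x) \<bullet> y \<noteq> 0)"
    proof (cases "G \<noteq> {} \<and> G \<subset> F")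
      case True
      then have "span G \<subset> span F"
        using C FG span_proper_face by blast
      then show ?thesis
        using generic_closest_point_not_in[OF C FG(1) subspace_span, of G]
        by (auto elim: eventually_mono)
    next
      case False
      then show ?thesis
        by (intro always_eventually) blast
    qed
  qed
  then show ?thesis
  proof (rule eventually_mono, intro allI impI)
    fix x F
    let ?p = "closest_point C x"
    assume gen: "\<forall>F\<in>\<F>. \<forall>G\<in>\<F>. G \<noteq> {} \<and> G \<subset> F \<longrightarrow>
      ?p \<in> span G \<longrightarrow> (\<exists>y\<in>F. (x - ?p) \<bullet> y \<noteq> 0)"
    assume F: "F face_of C \<and> F \<noteq> {}"
    obtain G where G: "G face_of C" "?p \<in> rel_interior G"
      using C closest_point_polyhedral_cone(1)[OF C] exists_face_with_rel_interior
      by (metis polyhedral_cone_def)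
    have pG: "?p \<in> G"
      using G(2) rel_interior_subset by blast
    show "x \<in> Pi_cone F C \<longleftrightarrow> ?p \<in> rel_interior F"
    proof
      assume "x \<in> Pi_cone F C"
      then have p: "?p \<in> F" "\<forall>y\<in>F. (x - ?p) \<bullet> y = 0"
        using mem_Pi_cone_iff[OF C] F by blast+
      have "G \<subseteq> F"
        by (rule subset_of_face_of[of F C]) (use F G p face_of_imp_subset in blast)+
      moreover have "?p \<in> span G"
        using pG by (rule span_base)
      ultimately have "G = F"
        using gen p(2) F G(1) pG unfolding \<F>_def by blast
      with G(2) show "?p \<in> rel_interior F"
        by simp
    next
      assume "?p \<in> rel_interior F"
      then show "x \<in> Pi_cone F C"
        using mem_Pi_cone_iff[OF C] residual_orthogonal_face[OF C] F rel_interior_subset by blast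
    qed
  qed
qed

lemma sum_fun_apply: "(\<Sum>i\<in>I. f i) x = (\<Sum>i\<in>I. f i x)" for f :: "'i \<Rightarrow> 'a \<Rightarrow> 'b::comm_monoid_add"
  by (induction I rule: infinite_finite_induct) simp_all

lemma generic_V_cone:
  assumes C: "polyhedral_cone C"
  shows "\<forall>\<^sub>F x in generic. V_cone k C x = indicator (open_skeleton k C) (closest_point C x)"
  using generic_mem_Pi_cone_iff[OF C]
proof (rule eventually_mono)
  fix x
  let ?p = "closest_point C x"
  assume *: "\<forall>F. F face_of C \<and> F \<noteq> {} \<longrightarrow> (x \<in> Pi_cone F C \<longleftrightarrow> ?p \<in> rel_interior F)"
  have "V_cone k C x = (\<Sum>F\<in>faces_of_dim k C. indicator (Pi_cone F C) x)"
    unfolding V_cone_def by (rule sum_fun_apply)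
  also have "\<dots> = (\<Sum>F\<in>faces_of_dim k C. indicator (rel_interior F) ?p)"
    using * by (intro sum.cong) (auto simp: faces_of_dim_def indicator_def)
  also have "\<dots> = indicator (open_skeleton k C) ?p"
    unfolding open_skeleton_def
  proof (rule indicator_UN_disjoint[symmetric])
    show "finite (faces_of_dim k C)"
      using C by (rule finite_faces_of_dim)
    show "disjoint_family_on rel_interior (faces_of_dim k C)"
      unfolding disjoint_family_on_def faces_of_dim_def using face_of_eq by blast
  qed
  finally show "V_cone k C x = indicator (open_skeleton k C) ?p" .
qed

lemma Int_hyperplane_face_of_Int_halfspace:
  assumes "convex C"
  shows "C \<inter> {y. a \<bullet> y = 0} face_of C \<inter> {y. a \<bullet> y \<ge> 0}"
    and "C \<inter> {y. a \<bullet> y = 0} face_of C \<inter> {y. a \<bullet> y \<le> 0}"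
proof -
  have "C \<inter> {y. a \<bullet> y \<ge> 0} \<inter> {y. a \<bullet> y = 0} face_of C \<inter> {y. a \<bullet> y \<ge> 0}"
    using assms
    by (intro face_of_Int_supporting_hyperplane_ge convex_Int convex_halfspace_ge) auto
  moreover have "C \<inter> {y. a \<bullet> y \<ge> 0} \<inter> {y. a \<bullet> y = 0} = C \<inter> {y. a \<bullet> y = 0}"
    by auto
  ultimately show "C \<inter> {y. a \<bullet> y = 0} face_of C \<inter> {y. a \<bullet> y \<ge> 0}"
    by simp
  have "C \<inter> {y. a \<bullet> y \<le> 0} \<inter> {y. a \<bullet> y = 0} face_of C \<inter> {y. a \<bullet> y \<le> 0}"
    using assms
    by (intro face_of_Int_supporting_hyperplane_le convex_Int convex_halfspace_le) auto
  moreover have "C \<inter> {y. a \<bullet> y \<le> 0} \<inter> {y. a \<bullet> y = 0} = C \<inter> {y. a \<bullet> y = 0}"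
    by auto
  ultimately show "C \<inter> {y. a \<bullet> y = 0} face_of C \<inter> {y. a \<bullet> y \<le> 0}"
    by simp
qed

text \<open>
  If the face \<open>F\<close> of \<open>C\<close> around the nearest point crossed \<open>H\<close>, then \<open>C \<inter> H\<close> would have a face of smaller
  dimension there. But then the nearest point would lie in the proper subspace \<open>span F \<inter> H\<close> of
  \<open>span F\<close>, with residual orthogonal to \<open>F\<close>; this is not generic. So \<open>F \<subseteq> H\<close>, and \<open>F\<close> is a
  face of both cones.
\<close>
lemma generic_open_skeleton_Int_hyperplane:
  fixes a :: "'a::euclidean_space"
  assumes C: "polyhedral_cone C"
  defines "H \<equiv> {y. a \<bullet> y = 0}"
  shows "\<forall>\<^sub>F x in generic. closest_point C x \<in> H \<longrightarrow>
    (closest_point C x \<in> open_skeleton k C \<longleftrightarrow> closest_point C x \<in> open_skeleton k (C \<inter> H))"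
proof -
  have "\<forall>\<^sub>F x in generic. \<forall>F\<in>{F. F face_of C}. \<not> F \<subseteq> H \<longrightarrow>
      closest_point C x \<in> span F \<inter> H \<longrightarrow> (\<exists>y\<in>F. (x - closest_point C x) \<bullet> y \<noteq> 0)"
  proof (intro eventually_ball_finite finite_faces C ballI)
    fix F
    assume "F \<in> {F. F face_of C}"
    then have F: "F face_of C"
      by simp
    show "\<forall>\<^sub>F x in generic. \<not> F \<subseteq> H \<longrightarrow>
      closest_point C x \<in> span F \<inter> H \<longrightarrow> (\<exists>y\<in>F. (x - closest_point C x) \<bullet> y \<noteq> 0)"
    proof (cases "F \<subseteq> H")
      case False
      have "span F \<inter> H \<subset> span F"
        using False span_superset[of F] by blast
      moreover have "subspace (span F \<inter> H)"
        unfolding H_def by (intro subspace_inter subspace_span subspace_hyperplane)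
      ultimately show ?thesis
        using generic_closest_point_not_in[OF C F, of "span F \<inter> H"]
        by (auto elim: eventually_mono)
    qed simp
  qed
  then show ?thesis
  proof (rule eventually_mono, intro impI)
    fix x
    let ?p = "closest_point C x"
    assume gen: "\<forall>F\<in>{F. F face_of C}. \<not> F \<subseteq> H \<longrightarrow>
      ?p \<in> span F \<inter> H \<longrightarrow> (\<exists>y\<in>F. (x - ?p) \<bullet> y \<noteq> 0)"
    assume pH: "?p \<in> H"
    obtain F where F: "F face_of C" "?p \<in> rel_interior F"
      using C closest_point_polyhedral_cone(1)[OF C] exists_face_with_rel_interior
      by (metis polyhedral_cone_def)
    have "?p \<in> span F"
      using F(2) rel_interior_subset span_base by blast
    then have "F \<subseteq> H"
      using gen F(1) pH residual_orthogonal_face[OF C F] by blast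
    then have "F face_of C \<inter> H"
      using F(1) face_of_imp_subset by (intro face_of_subset[OF F(1)]) auto
    then show "?p \<in> open_skeleton k C \<longleftrightarrow> ?p \<in> open_skeleton k (C \<inter> H)"
      using open_skeleton_iff F by metis
  qed
qed

text \<open>
  A point \<open>q\<close> nearest to \<open>x\<close> in the negative half of \<open>C\<close>, but off the hyperplane, would be a local
  minimum of the distance on all of \<open>C\<close>, and hence by convexity equal to the nearest point of \<open>C\<close>,
  which is on the other side.
\<close>
lemma closest_point_opposite_halfspace:
  fixes a :: "'a::euclidean_space"
  assumes C: "polyhedral_cone C" and pos: "a \<bullet> closest_point C x > 0"
  shows "a \<bullet> closest_point (C \<inter> {y. a \<bullet> y \<le> 0}) x = 0"
proof (rule ccontr)
  define D where "D = C \<inter> {y. a \<bullet> y \<le> 0}"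
  define p where "p = closest_point C x"
  define q where "q = closest_point D x"
  assume "\<not> a \<bullet> closest_point (C \<inter> {y. a \<bullet> y \<le> 0}) x = 0"
  then have q0: "a \<bullet> q \<noteq> 0"
    by (simp add: q_def D_def)
  have D: "polyhedral_cone D"
    unfolding D_def by (intro polyhedral_cone_Int C polyhedral_cone_halfspace)
  have pC: "p \<in> C" and qD: "q \<in> D"
    unfolding p_def q_def by (rule closest_point_polyhedral_cone(1), fact)+
  then have neg: "a \<bullet> q < 0" and qC: "q \<in> C" and pos: "a \<bullet> p > 0"
    using q0 pos by (auto simp: D_def p_def)
  \<comment> \<open>The point where the segment from \<open>q\<close> to \<open>p\<close> crosses the hyperplane.\<close>
  define u where "u = a \<bullet> q / (a \<bullet> q - a \<bullet> p)"
  define r where "r = (1 - u) *\<^sub>R q + u *\<^sub>R p"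
  have u: "0 < u" "u \<le> 1"
    using neg pos by (auto simp: u_def zero_less_divide_iff divide_le_eq)
  have "a \<bullet> r = a \<bullet> q - u * (a \<bullet> q - a \<bullet> p)"
    by (simp add: r_def inner_right_distrib algebra_simps)
  also have "\<dots> = 0"
    using neg pos by (simp add: u_def)
  finally have "a \<bullet> r = 0" .
  moreover have "r \<in> C"
    unfolding r_def using polyhedral_cone_convex[OF C] pC qC u by (intro convexD) auto
  ultimately have "r \<in> D"
    by (simp add: D_def)
  then have "(x - q) \<bullet> (r - q) \<le> 0"
    unfolding q_def using D by (intro closest_point_polyhedral_cone(2))
  moreover have "r - q = u *\<^sub>R (p - q)"
    by (simp add: r_def algebra_simps)
  ultimately have "(x - q) \<bullet> (p - q) \<le> 0"
    using u(1) by (simp add: mult_le_0_iff)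
  moreover have "(x - p) \<bullet> (q - p) \<le> 0"
    unfolding p_def using C qC by (rule closest_point_polyhedral_cone(2))
  ultimately have "p = q"
    by (intro variational_inequalities_eq)
  with neg pos show False
    by simp
qed

lemma open_skeleton_split_positive:
  fixes a :: "'a::euclidean_space"
  assumes C: "polyhedral_cone C" and pos: "a \<bullet> closest_point C x > 0"
  defines "P \<equiv> C \<inter> {y. a \<bullet> y \<ge> 0}" and "N \<equiv> C \<inter> {y. a \<bullet> y \<le> 0}" and "Z \<equiv> C \<inter> {y. a \<bullet> y = 0}"
  shows "closest_point P x \<in> open_skeleton k P \<longleftrightarrow> closest_point C x \<in> open_skeleton k C"
    and "closest_point N x \<in> open_skeleton k N \<longleftrightarrow> closest_point Z x \<in> open_skeleton k Z"
proof -
  have poly: "polyhedral_cone P" "polyhedral_cone N" "polyhedral_cone Z"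
    unfolding P_def N_def Z_def by (intro polyhedral_cone_Int C polyhedral_cone_halfspace)+
  have pC: "closest_point C x \<in> C"
    using C by (rule closest_point_polyhedral_cone)
  have "closest_point P x = closest_point C x"
    by (rule closest_point_subset_eq[OF C poly(1)]) (use pC pos in \<open>auto simp: P_def\<close>)
  then show "closest_point P x \<in> open_skeleton k P \<longleftrightarrow> closest_point C x \<in> open_skeleton k C"
    using open_skeleton_Int_halfspace[OF _ pC pos] C by (simp add: P_def polyhedral_cone_def)
  have "closest_point N x \<in> N"
    using poly(2) by (rule closest_point_polyhedral_cone)
  then have qZ: "closest_point N x \<in> Z"
    using closest_point_opposite_halfspace[OF C pos] by (simp add: N_def Z_def)
  then have eq: "closest_point Z x = closest_point N x"
    by (intro closest_point_subset_eq[OF poly(2,3)]) (auto simp: N_def Z_def)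
  have "Z face_of N"
    unfolding Z_def N_def using C polyhedral_cone_convex Int_hyperplane_face_of_Int_halfspace by blast
  then show "closest_point N x \<in> open_skeleton k N \<longleftrightarrow> closest_point Z x \<in> open_skeleton k Z"
    unfolding eq using open_skeleton_face[OF _ _ qZ] poly(2) by (simp add: polyhedral_cone_def)
qed

text \<open>
  Up to lower dimensional cones, \<open>V_cone k\<close> is a valuation. If the point of \<open>C\<close> nearest to \<open>x\<close> is strictly
  on one side, then that half of \<open>C\<close> contributes as \<open>C\<close> does, and the other half contributes as the slice
  does. If it is on the hyperplane, then all four cones have the same nearest point, and it lies in
  the same relatively open face of each of them.
\<close>
lemma generic_V_cone_split:
  fixes a :: "'a::euclidean_space"
  assumes C: "polyhedral_cone C"
  shows "\<forall>\<^sub>F x in generic. V_cone k (C \<inter> {y. a \<bullet> y \<ge> 0}) x + V_cone k (C \<inter> {y. a \<bullet> y \<le> 0}) x =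
    V_cone k C x + V_cone k (C \<inter> {y. a \<bullet> y = 0}) x"
proof -
  let ?P = "C \<inter> {y. a \<bullet> y \<ge> 0}" and ?N = "C \<inter> {y. a \<bullet> y \<le> 0}" and ?Z = "C \<inter> {y. a \<bullet> y = 0}"
  have poly: "polyhedral_cone ?P" "polyhedral_cone ?N" "polyhedral_cone ?Z"
    by (intro polyhedral_cone_Int C polyhedral_cone_halfspace)+
  have faces: "?Z face_of ?P" "?Z face_of ?N"
    using C polyhedral_cone_convex Int_hyperplane_face_of_Int_halfspace by blast+
  show ?thesis
    using generic_V_cone[OF C, of k] generic_V_cone[OF poly(1), of k] generic_V_cone[OF poly(2), of k]
      generic_V_cone[OF poly(3), of k] generic_open_skeleton_Int_hyperplane[OF C, of a k]
  proof eventually_elim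
    case (elim x)
    note V = elim(1-4) and hyp = elim(5)
    let ?p = "closest_point C x"
    have pC: "?p \<in> C"
      using C by (rule closest_point_polyhedral_cone)
    consider "a \<bullet> ?p > 0" | "- a \<bullet> ?p > 0" | "a \<bullet> ?p = 0"
      by (cases "a \<bullet> ?p" "0::real" rule: linorder_cases) auto
    then show ?case
    proof cases
      case 1
      show ?thesis
        unfolding V using open_skeleton_split_positive[OF C 1, of k] by (simp add: indicator_def)
    next
      case 2
      show ?thesis
        unfolding V using open_skeleton_split_positive[OF C 2, of k] by (simp add: indicator_def)
    next
      case 3
      then have pZ: "?p \<in> ?Z"
        using pC by simp
      have eq: "closest_point ?P x = ?p" "closest_point ?N x = ?p" "closest_point ?Z x = ?p"
        using closest_point_subset_eq[OF C poly(1), of x] closest_point_subset_eq[OF C poly(2), of x]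
          closest_point_subset_eq[OF C poly(3), of x] pZ by auto
      have "?p \<in> open_skeleton k ?P \<longleftrightarrow> ?p \<in> open_skeleton k ?Z"
        "?p \<in> open_skeleton k ?N \<longleftrightarrow> ?p \<in> open_skeleton k ?Z"
        using open_skeleton_face[OF _ faces(1) pZ] open_skeleton_face[OF _ faces(2) pZ] poly
        by (simp_all add: polyhedral_cone_def)
      moreover have "?p \<in> open_skeleton k C \<longleftrightarrow> ?p \<in> open_skeleton k ?Z"
        using hyp 3 by simp
      ultimately show ?thesis
        unfolding V eq by (simp add: indicator_def)
    qed
  qed
qed

section \<open>Cutting the regions of an arrangement by one more hyperplane\<close>

text \<open>
  Each block is clopen in every connected subset of \<open>S\<close> that contains it, so it is a maximal connected
  set; the blocks cover \<open>S\<close>, so there are no further components.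
\<close>
lemma components_eq_open_partition:
  fixes S :: "'a::topological_space set"
  assumes disj: "pairwise disjnt \<P>" and un: "\<Union>\<P> = S"
    and P: "\<And>X. X \<in> \<P> \<Longrightarrow> openin (top_of_set S) X \<and> connected X \<and> X \<noteq> {}"
  shows "components S = \<P>"
proof -
  have comp: "X \<in> components S" if X: "X \<in> \<P>" for X
    unfolding in_components_maximal
  proof (intro conjI allI impI)
    show "X \<noteq> {}" "connected X" "X \<subseteq> S"
      using P[OF X] un X by auto
    fix D
    assume D: "D \<noteq> {} \<and> X \<subseteq> D \<and> D \<subseteq> S \<and> connected D"
    have "openin (top_of_set S) (\<Union>(\<P> - {X}))"
      using P by blast
    then have "openin (top_of_set D) (D \<inter> \<Union>(\<P> - {X}))"
      using D by (metis inf.absorb_iff2 inf_commute openin_subtopology_Int subtopology_subtopology)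
    moreover have "X \<inter> \<Union>(\<P> - {X}) = {}"
      using pairwiseD[OF disj X] unfolding disjnt_def by blast
    then have "D - X = D \<inter> \<Union>(\<P> - {X})"
      using D un by blast
    ultimately have "closedin (top_of_set D) X"
      using D by (simp add: closedin_def)
    moreover have "openin (top_of_set D) X"
      using P[OF X] D openin_subset_trans by blast
    ultimately show "D = X"
      using D P[OF X] unfolding connected_clopen by blast
  qed
  moreover have "C \<in> \<P>" if C: "C \<in> components S" for C
  proof -
    obtain x where x: "x \<in> C"
      using in_components_nonempty[OF C] by blast
    then obtain X where X: "X \<in> \<P>" "x \<in> X"
      using un in_components_subset[OF C] by blast
    then have "C = X"
      using components_eq[OF C comp[OF X(1)]] x by blast
    with X show ?thesis
      by simp
  qed
  ultimately show ?thesis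
    by blast
qed

text \<open>
  The empty set is removed because a component may miss the hyperplane or one of its sides.
\<close>
lemma components_cut_hyperplane:
  fixes S :: "'a::euclidean_space set"
  assumes "\<And>c. c \<in> components S \<Longrightarrow> convex c \<and> openin (top_of_set S) c"
  shows "components (S - {y. a \<bullet> y = 0}) =
      ((\<lambda>c. c \<inter> {y. a \<bullet> y > 0}) ` components S \<union> (\<lambda>c. c \<inter> {y. a \<bullet> y < 0}) ` components S) - {{}}"
      (is "components (S - ?Z) = (?p ` ?K \<union> ?n ` ?K) - {{}}")
    and "components (S \<inter> {y. a \<bullet> y = 0}) = (\<lambda>c. c \<inter> {y. a \<bullet> y = 0}) ` components S - {{}}"
      (is "_ = ?z ` ?K - {{}}")
proof -
  have un: "\<Union>?K = S"
    by (rule Union_components)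
  have disj: "c \<inter> c' = {}" if "c \<in> ?K" "c' \<in> ?K" "c \<noteq> c'" for c c'
    using components_eq[OF that(1,2)] that(3) by blast
  have open_slice: "openin (top_of_set (S - ?Z)) (c \<inter> U)" if c: "c \<in> ?K" and U: "open U" "U \<inter> ?Z = {}" for c U
  proof -
    obtain T where T: "open T" "c = S \<inter> T"
      using assms[OF c] unfolding openin_open by blast
    have "c \<inter> U = (S - ?Z) \<inter> (T \<inter> U)"
      using T(2) U(2) by blast
    then show ?thesis
      unfolding openin_open using T(1) U(1) by blast
  qed
  show "components (S - ?Z) = (?p ` ?K \<union> ?n ` ?K) - {{}}"
  proof (rule components_eq_open_partition)
    show "pairwise disjnt ((?p ` ?K \<union> ?n ` ?K) - {{}})"
    proof (rule pairwiseI)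
      fix X Y
      assume X: "X \<in> (?p ` ?K \<union> ?n ` ?K) - {{}}" and Y: "Y \<in> (?p ` ?K \<union> ?n ` ?K) - {{}}"
        and "X \<noteq> Y"
      obtain c where c: "c \<in> ?K" "X = ?p c \<or> X = ?n c"
        using X by blast
      obtain c' where c': "c' \<in> ?K" "Y = ?p c' \<or> Y = ?n c'"
        using Y by blast
      show "disjnt X Y"
      proof (cases "c = c'")
        case True
        then show ?thesis
          using c c' \<open>X \<noteq> Y\<close> by (auto simp: disjnt_iff)
      next
        case False
        then show ?thesis
          using disj[OF c(1) c'(1)] c c' by (auto simp: disjnt_iff)
      qed
    qed
    have "\<Union>((?p ` ?K \<union> ?n ` ?K) - {{}}) =
        \<Union>?K \<inter> {y. a \<bullet> y > 0} \<union> \<Union>?K \<inter> {y. a \<bullet> y < 0}"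
      by blast
    also have "\<dots> = S - ?Z"
      unfolding un by (auto simp: neq_iff)
    finally show "\<Union>((?p ` ?K \<union> ?n ` ?K) - {{}}) = S - ?Z" .
    fix X
    assume X: "X \<in> (?p ` ?K \<union> ?n ` ?K) - {{}}"
    then obtain c where c: "c \<in> ?K" "X = ?p c \<or> X = ?n c"
      by blast
    have "convex X"
      using assms[OF c(1)] c(2) by (auto intro!: convex_Int convex_halfspace_gt convex_halfspace_lt)
    moreover have "{y. a \<bullet> y > 0} \<inter> ?Z = {}" "{y. a \<bullet> y < 0} \<inter> ?Z = {}"
      by auto
    then have "openin (top_of_set (S - ?Z)) X"
      using c(2) open_slice[OF c(1) open_halfspace_gt[of 0 a]] open_slice[OF c(1) open_halfspace_lt[of a 0]]
      by auto
    ultimately show "openin (top_of_set (S - ?Z)) X \<and> connected X \<and> X \<noteq> {}"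
      using X convex_connected by auto
  qed
  show "components (S \<inter> ?Z) = ?z ` ?K - {{}}"
  proof (rule components_eq_open_partition)
    show "pairwise disjnt (?z ` ?K - {{}})"
    proof (rule pairwiseI)
      fix X Y
      assume X: "X \<in> ?z ` ?K - {{}}" and Y: "Y \<in> ?z ` ?K - {{}}" and "X \<noteq> Y"
      then obtain c c' where "c \<in> ?K" "X = ?z c" "c' \<in> ?K" "Y = ?z c'" "c \<noteq> c'"
        by blast
      then show "disjnt X Y"
        using disj by (auto simp: disjnt_iff)
    qed
    show "\<Union>(?z ` ?K - {{}}) = S \<inter> ?Z"
      using un by blast
    fix X
    assume X: "X \<in> ?z ` ?K - {{}}"
    then obtain c where c: "c \<in> ?K" "X = ?z c"
      by blast
    have "convex X"
      using assms[OF c(1)] c(2) by (auto intro!: convex_Int convex_hyperplane)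
    moreover have "openin (top_of_set (S \<inter> ?Z)) X"
      using assms[OF c(1)] c(2) unfolding openin_open by blast
    ultimately show "openin (top_of_set (S \<inter> ?Z)) X \<and> connected X \<and> X \<noteq> {}"
      using X convex_connected by auto
  qed
qed

text \<open>
  The properties of a region of an arrangement in \<open>L\<close> that survive cutting by a further hyperplane.
\<close>
definition open_cell :: "'a::euclidean_space set \<Rightarrow> 'a set \<Rightarrow> bool" where
  "open_cell L c \<longleftrightarrow>
    c \<noteq> {} \<and> convex c \<and> openin (top_of_set L) c \<and> polyhedral_cone (closure c)"

lemma open_cell_rel_interior:
  assumes "affine L" "open_cell L c"
  shows "rel_interior c = c"
proof -
  have c: "openin (top_of_set L) c" "c \<noteq> {}"
    using assms(2) by (auto simp: open_cell_def)
  have hull: "affine hull L = L"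
    using assms(1) by (simp add: affine_hull_eq)
  then have "affine hull c = L"
    using affine_hull_openin[of L c] c unfolding hull by blast
  with c show ?thesis
    by (simp add: rel_interior_eq)
qed

text \<open>
  Closure commutes with intersection for convex sets whose relative interiors meet, and both the cell
  and the open halfspace (or the hyperplane) equal their relative interiors.
\<close>
lemma closure_open_cell_Int:
  assumes L: "affine L" and c: "open_cell L c"
  shows "c \<inter> {y. a \<bullet> y > 0} \<noteq> {} \<Longrightarrow> closure (c \<inter> {y. a \<bullet> y > 0}) = closure c \<inter> {y. a \<bullet> y \<ge> 0}"
    and "c \<inter> {y. a \<bullet> y < 0} \<noteq> {} \<Longrightarrow> closure (c \<inter> {y. a \<bullet> y < 0}) = closure c \<inter> {y. a \<bullet> y \<le> 0}"
    and "c \<inter> {y. a \<bullet> y = 0} \<noteq> {} \<Longrightarrow> closure (c \<inter> {y. a \<bullet> y = 0}) = closure c \<inter> {y. a \<bullet> y = 0}"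
proof -
  have conv: "convex c" and ri: "rel_interior c = c"
    using c L open_cell_rel_interior by (auto simp: open_cell_def)
  have cl: "closure (c \<inter> U) = closure c \<inter> closure U"
    if "convex U" "rel_interior U = U" "c \<inter> U \<noteq> {}" for U
    using closure_Int_convex[OF conv that(1)] that(2,3) ri by simp
  show "closure (c \<inter> {y. a \<bullet> y > 0}) = closure c \<inter> {y. a \<bullet> y \<ge> 0}" if ne: "c \<inter> {y. a \<bullet> y > 0} \<noteq> {}"
  proof -
    have "a \<noteq> 0"
      using ne by auto
    then show ?thesis
      using cl[OF convex_halfspace_gt _ ne] rel_interior_open[OF open_halfspace_gt[of 0 a]]
        closure_halfspace_gt[of a 0] by simp
  qed
  show "closure (c \<inter> {y. a \<bullet> y < 0}) = closure c \<inter> {y. a \<bullet> y \<le> 0}" if ne: "c \<inter> {y. a \<bullet> y < 0} \<noteq> {}"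
  proof -
    have "a \<noteq> 0"
      using ne by auto
    then show ?thesis
      using cl[OF convex_halfspace_lt _ ne] rel_interior_open[OF open_halfspace_lt[of a 0]]
        closure_halfspace_lt[of a 0] by simp
  qed
  show "closure (c \<inter> {y. a \<bullet> y = 0}) = closure c \<inter> {y. a \<bullet> y = 0}" if ne: "c \<inter> {y. a \<bullet> y = 0} \<noteq> {}"
    using cl[OF convex_hyperplane _ ne] rel_interior_affine[OF affine_hyperplane[of a 0]]
      closure_closed[OF closed_hyperplane[of a 0]] by simp
qed

lemma open_cell_Int_halfspace:
  assumes L: "affine L" and c: "open_cell L c"
  shows "c \<inter> {y. a \<bullet> y > 0} \<noteq> {} \<Longrightarrow> open_cell L (c \<inter> {y. a \<bullet> y > 0})"
    and "c \<inter> {y. a \<bullet> y < 0} \<noteq> {} \<Longrightarrow> open_cell L (c \<inter> {y. a \<bullet> y < 0})"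
  using c closure_open_cell_Int[OF L c, of a] polyhedral_cone_Int[OF _ polyhedral_cone_halfspace(1)[of a]]
    polyhedral_cone_Int[OF _ polyhedral_cone_halfspace(2)[of a]]
  by (auto simp: open_cell_def convex_Int convex_halfspace_gt convex_halfspace_lt
      open_halfspace_gt open_halfspace_lt openin_Int_open)

text \<open>
  Cells are open in \<open>L\<close>, and moving from \<open>z\<close> in the directions \<open>a\<close> and \<open>-a\<close> does not leave \<open>L\<close>.
\<close>
lemma open_cell_meets_both_sides:
  assumes L: "subspace L" and c: "open_cell L c" and a: "a \<in> L" "a \<noteq> 0"
    and z: "z \<in> c" "a \<bullet> z = 0"
  shows "c \<inter> {y. a \<bullet> y > 0} \<noteq> {}" "c \<inter> {y. a \<bullet> y < 0} \<noteq> {}"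
proof -
  have "openin (top_of_set L) c"
    using c by (simp add: open_cell_def)
  then obtain e where e: "e > 0" "c \<subseteq> L" "ball z e \<inter> L \<subseteq> c"
    using z(1) unfolding openin_contains_ball by blast
  define t where "t = e / (2 * norm a)"
  have t: "t > 0" "t * norm a < e"
    using e(1) a(2) by (auto simp: t_def)
  have "z \<in> L"
    using z(1) e(2) by blast
  then have "z + t *\<^sub>R a \<in> L" "z - t *\<^sub>R a \<in> L"
    using L a(1) by (auto intro!: subspace_add subspace_diff subspace_scale)
  moreover have "z + t *\<^sub>R a \<in> ball z e" "z - t *\<^sub>R a \<in> ball z e"
    using t by (auto simp: dist_norm)
  ultimately have "z + t *\<^sub>R a \<in> c" "z - t *\<^sub>R a \<in> c"
    using e(3) by blast+
  moreover have "a \<bullet> (z + t *\<^sub>R a) > 0" "a \<bullet> (z - t *\<^sub>R a) < 0"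
    using z(2) t(1) a(2) by (auto simp: inner_add_right inner_diff_right)
  ultimately show "c \<inter> {y. a \<bullet> y > 0} \<noteq> {}" "c \<inter> {y. a \<bullet> y < 0} \<noteq> {}"
    by blast+
qed

text \<open>
  A cell that misses the hyperplane or one side of it thereby contributes zero there, so sums over
  pieces need not distinguish the cells that are cut from those that are not.
\<close>
lemma V_cone_empty: "V_cone k {} = 0"
proof -
  have "faces_of_dim k {} = ({} :: 'a set set)"
    by (auto simp: faces_of_dim_def)
  then show ?thesis
    by (simp add: V_cone_def)
qed

text \<open>
  A cell that misses the hyperplane lies on one side of it, and both sides of the identity reduce to the
  contribution of the cell itself. For all other cells this is the valuation property of \<open>V_cone k\<close>.
\<close>
lemma generic_V_cone_cut_cell:
  fixes a :: "'a::euclidean_space"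
  assumes L: "subspace L" and c: "open_cell L c" and a: "a \<in> L" "a \<noteq> 0"
  shows "\<forall>\<^sub>F x in generic.
    V_cone k (closure (c \<inter> {y. a \<bullet> y > 0})) x + V_cone k (closure (c \<inter> {y. a \<bullet> y < 0})) x =
    V_cone k (closure c) x + V_cone k (closure (c \<inter> {y. a \<bullet> y = 0})) x"
proof (cases "c \<inter> {y. a \<bullet> y = 0} = {}")
  case True
  have "connected c"
    using c convex_connected by (auto simp: open_cell_def)
  then have "c \<subseteq> {y. a \<bullet> y > 0} \<or> c \<subseteq> {y. a \<bullet> y < 0}"
    using connected_ivt_hyperplane[of c _ _ a 0] True
    by (smt (verit, best) Int_iff disjoint_iff mem_Collect_eq subsetI)
  then consider "c \<inter> {y. a \<bullet> y > 0} = c" "c \<inter> {y. a \<bullet> y < 0} = {}"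
    | "c \<inter> {y. a \<bullet> y > 0} = {}" "c \<inter> {y. a \<bullet> y < 0} = c"
    by fastforce
  then show ?thesis
    by cases (simp_all add: True V_cone_empty)
next
  case False
  then obtain z where z: "z \<in> c" "a \<bullet> z = 0"
    by blast
  have "affine L"
    using L by (rule subspace_imp_affine)
  note closure_eqs = closure_open_cell_Int[OF this c, of a]
  have "polyhedral_cone (closure c)"
    using c by (simp add: open_cell_def)
  then show ?thesis
    unfolding closure_eqs(1)[OF open_cell_meets_both_sides(1)[OF L c a z]]
      closure_eqs(2)[OF open_cell_meets_both_sides(2)[OF L c a z]] closure_eqs(3)[OF False]
    by (rule generic_V_cone_split)
qed

lemma generic_sum_V_cone_cut:
  fixes S :: "'a::euclidean_space set"
  assumes L: "subspace L" "S \<subseteq> L" and fin: "finite (components S)"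
    and cell: "\<And>c. c \<in> components S \<Longrightarrow> open_cell L c" and a: "a \<in> L" "a \<noteq> 0"
  shows "\<forall>\<^sub>F x in generic.
    (\<Sum>c\<in>components (S - {y. a \<bullet> y = 0}). V_cone k (closure c) x) =
    (\<Sum>c\<in>components S. V_cone k (closure c) x) +
    (\<Sum>c\<in>components (S \<inter> {y. a \<bullet> y = 0}). V_cone k (closure c) x)"
proof -
  let ?K = "components S"
  let ?p = "\<lambda>c. c \<inter> {y. a \<bullet> y > 0}" and ?n = "\<lambda>c. c \<inter> {y. a \<bullet> y < 0}"
    and ?z = "\<lambda>c. c \<inter> {y. a \<bullet> y = 0}"
  have "convex c \<and> openin (top_of_set S) c" if c: "c \<in> ?K" for c
    using cell[OF c] in_components_subset[OF c] L(2) openin_subset_trans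
    unfolding open_cell_def by blast
  note comps = components_cut_hyperplane[OF this, where a = a]
  have disj: "c \<inter> c' = {}" if "c \<in> ?K" "c' \<in> ?K" "c \<noteq> c'" for c c'
    using components_eq[OF that(1,2)] that(3) by blast
  have "\<forall>\<^sub>F x in generic. \<forall>c\<in>?K.
      V_cone k (closure (?p c)) x + V_cone k (closure (?n c)) x =
      V_cone k (closure c) x + V_cone k (closure (?z c)) x"
    using cell by (intro eventually_ball_finite fin ballI generic_V_cone_cut_cell[OF L(1) _ a])
  then show ?thesis
  proof eventually_elim
    case (elim x)
    define g where "g c = V_cone k (closure c) x" for c
    have g0: "g {} = 0"
      by (simp add: g_def V_cone_empty)
    have image: "sum g ((\<lambda>c. c \<inter> U) ` ?K) = (\<Sum>c\<in>?K. g (c \<inter> U))" for U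
    proof -
      have "sum g ((\<lambda>c. c \<inter> U) ` ?K) = sum (g \<circ> (\<lambda>c. c \<inter> U)) ?K"
      proof (rule sum.reindex_nontrivial[OF fin])
        fix c c'
        assume "c \<in> ?K" "c' \<in> ?K" "c \<noteq> c'" "c \<inter> U = c' \<inter> U"
        then have "c \<inter> U = {}"
          using disj by blast
        then show "g (c \<inter> U) = 0"
          by (simp add: g0)
      qed
      then show ?thesis
        by (simp add: o_def)
    qed
    have "sum g (components (S - {y. a \<bullet> y = 0})) = sum g (?p ` ?K \<union> ?n ` ?K)"
      using fin g0 by (simp only: comps(1), intro sum.mono_neutral_left) auto
    also have "\<dots> = sum g (?p ` ?K) + sum g (?n ` ?K)"
    proof (intro sum.union_inter_neutral finite_imageI fin ballI)
      fix X
      assume "X \<in> ?p ` ?K \<inter> ?n ` ?K"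
      then have "X = {}"
        by auto
      then show "g X = 0"
        by (simp add: g0)
    qed
    also have "\<dots> = (\<Sum>c\<in>?K. g (?p c) + g (?n c))"
      unfolding image by (rule sum.distrib[symmetric])
    also have "\<dots> = (\<Sum>c\<in>?K. g c + g (?z c))"
      using elim by (intro sum.cong) (auto simp: g_def)
    also have "\<dots> = sum g ?K + sum g (?z ` ?K)"
      unfolding image by (rule sum.distrib)
    also have "sum g (?z ` ?K) = sum g (components (S \<inter> {y. a \<bullet> y = 0}))"
      using fin g0 by (simp only: comps(2), intro sum.mono_neutral_right) auto
    finally show ?case
      unfolding g_def .
  qed
qed

lemma hyperplane_normal:
  fixes L H :: "'a::euclidean_space set"
  assumes L: "subspace L" and H: "subspace H" "H \<subseteq> L" "dim L = dim H + 1"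
  obtains a where "a \<in> L" "a \<noteq> 0" "H = L \<inter> {y. a \<bullet> y = 0}"
proof -
  have "H \<noteq> L"
    using H(3) by auto
  then have "span H \<subset> span L"
    using L H(1,2) by (simp add: span_eq_iff[THEN iffD2] psubset_eq)
  then obtain a where a: "a \<noteq> 0" "a \<in> span L" "\<And>y. y \<in> span H \<Longrightarrow> orthogonal a y"
    using orthogonal_to_subspace_exists_gen by blast
  have aL: "a \<in> L"
    using a(2) L by (simp add: span_eq_iff[THEN iffD2])
  let ?K = "L \<inter> {y. a \<bullet> y = 0}"
  have K: "subspace ?K"
    using L by (intro subspace_inter subspace_hyperplane)
  have HK: "H \<subseteq> ?K"
    using a(3) H(2) by (auto simp: orthogonal_def span_base)
  have "a \<notin> ?K"
    using a(1) by simp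
  then have "?K \<noteq> L"
    using aL by blast
  then have "\<not> dim L \<le> dim ?K"
    using subspace_dim_equal[OF K L] by blast
  then have "H = ?K"
    using subspace_dim_equal[OF H(1) K HK] H(3) by simp
  with aL a(1) show thesis
    using that by blast
qed

lemma components_subspace:
  "subspace L \<Longrightarrow> components L = {L}" for L :: "'a::euclidean_space set"
  using components_eq_sing_iff[of L] subspace_0[of L]
  by (auto simp: convex_connected subspace_imp_convex)

text \<open>
  By induction on the hyperplanes, since each new hyperplane only cuts the cells that are already there.
\<close>
lemma arrangement_open_cells:
  fixes L :: "'a::euclidean_space set"
  assumes L: "subspace L" and A: "finite A" "\<And>H. H \<in> A \<Longrightarrow> subspace H \<and> H \<subseteq> L \<and> dim L = dim H + 1"
  shows "finite (components (L - \<Union>A)) \<and> (\<forall>c\<in>components (L - \<Union>A). open_cell L c)"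
  using A
proof (induction A rule: finite_induct)
  case empty
  have "open_cell L L"
    unfolding open_cell_def using L subspace_0[OF L]
    by (auto simp: subspace_imp_convex closure_closed closed_subspace polyhedral_cone_subspace)
  then show ?case
    by (simp add: components_subspace[OF L])
next
  case (insert H A)
  let ?S = "L - \<Union>A"
  have IH: "finite (components ?S)" "\<And>c. c \<in> components ?S \<Longrightarrow> open_cell L c"
    using insert.IH insert.prems by auto
  obtain a where a: "H = L \<inter> {y. a \<bullet> y = 0}"
    using hyperplane_normal[OF L, of H] insert.prems by blast
  have "convex c \<and> openin (top_of_set ?S) c" if c: "c \<in> components ?S" for c
    using IH(2)[OF c] in_components_subset[OF c] openin_subset_trans[of L c ?S]
    unfolding open_cell_def by blast
  note comps = components_cut_hyperplane(1)[OF this, where a = a]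
  have "L - \<Union>(insert H A) = ?S - {y. a \<bullet> y = 0}"
    unfolding a by blast
  then show ?case
    using IH(1) open_cell_Int_halfspace[OF subspace_imp_affine[OF L] IH(2), where a = a]
    by (simp only: comps) blast
qed

section \<open>Deletion and restriction\<close>

definition region_sum :: "nat \<Rightarrow> 'a::euclidean_space set \<Rightarrow> 'a set set \<Rightarrow> 'a \<Rightarrow> int" where
  "region_sum k L A x = (\<Sum>c\<in>components (L - \<Union>A). V_cone k (closure c) x)"

text \<open>
  Cutting the regions of the deletion by \<open>H\<close> gives the regions of \<open>A\<close>, and slicing them by \<open>H\<close> gives the
  regions of the restriction. The deletion may be the empty arrangement in \<open>L\<close>, whose only region is \<open>L\<close>,
  so that one-element arrangements obey the same rule.
\<close>
lemma generic_region_sum_deletion_restriction: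
  fixes L :: "'a::euclidean_space set"
  assumes arr: "arrangement L A" and H: "H \<in> A"
  shows "\<forall>\<^sub>F x in generic.
    region_sum k L A x = region_sum k L (deletion A H) x + region_sum k H (restriction A H) x"
proof -
  let ?S = "L - \<Union>(deletion A H)"
  have L: "subspace L"
    using arr by (simp add: arrangement_def)
  have hyp: "subspace K \<and> K \<subseteq> L \<and> dim L = dim K + 1" if "K \<in> A" for K
    using arr that unfolding arrangement_def by blast
  have "deletion A H \<subseteq> A"
    by (auto simp: deletion_def)
  then have cells: "finite (components ?S)" "\<And>c. c \<in> components ?S \<Longrightarrow> open_cell L c"
    using arrangement_open_cells[OF L, of "deletion A H"] hyp arr finite_subset
    unfolding arrangement_def by blast+
  obtain a where a: "a \<in> L" "a \<noteq> 0" "H = L \<inter> {y. a \<bullet> y = 0}"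
    using hyperplane_normal[OF L, of H] hyp[OF H] by blast
  have "L - \<Union>A = ?S - {y. a \<bullet> y = 0}"
    using H a(3) by (auto simp: deletion_def)
  moreover have "H - \<Union>(restriction A H) = ?S \<inter> {y. a \<bullet> y = 0}"
    using a(3) by (auto simp: deletion_def restriction_def)
  ultimately show ?thesis
    unfolding region_sum_def using generic_sum_V_cone_cut[OF L _ cells a(1,2), of k] by auto
qed

text \<open>
  The only nonempty face of \<open>L\<close> is \<open>L\<close> itself, and \<open>Pi_cone L L\<close> is the sum of \<open>L\<close> and its orthogonal
  complement, that is, the whole space.
\<close>
lemma V_cone_subspace:
  fixes L :: "'a::euclidean_space set"
  assumes L: "subspace L"
  shows "V_cone k L x = of_bool (k = dim L)"
proof -
  have faces: "F face_of L \<and> F \<noteq> {} \<longleftrightarrow> F = L" for F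
    using face_of_affine_trivial[of L F] L subspace_0[OF L]
    by (auto simp: subspace_imp_affine subspace_imp_convex face_of_refl)
  have dim: "aff_dim L = int (dim L)"
    using L by (rule aff_dim_subspace)
  have "faces_of_dim k L = {F. F = L \<and> k = dim L}"
    unfolding faces_of_dim_def using faces dim by (metis of_nat_eq_iff)
  then have "faces_of_dim k L = (if k = dim L then {L} else {})"
    by auto
  moreover have "x \<in> Pi_cone L L"
  proof -
    have "closest_point L x \<in> rel_interior L"
      using closest_point_polyhedral_cone(1)[OF polyhedral_cone_subspace[OF L]]
        rel_interior_affine[OF subspace_imp_affine[OF L]] by blast
    then show ?thesis
      using mem_Pi_cone_iff[OF polyhedral_cone_subspace[OF L], of L] faces[of L]
        residual_orthogonal_face[OF polyhedral_cone_subspace[OF L]] rel_interior_subset by blast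
  qed
  ultimately show ?thesis
    by (simp add: V_cone_def)
qed

lemma region_sum_empty:
  assumes "subspace L"
  shows "region_sum k L {} x = of_bool (k = dim L)"
  using assms by (simp add: region_sum_def components_subspace V_cone_subspace closure_closed closed_subspace)

text \<open>
  For one hyperplane \<open>H\<close>, the deletion in \<open>L\<close> and the restriction in \<open>H\<close> are empty arrangements; they
  contribute the monomials of degrees \<open>dim L\<close> and \<open>dim H = dim L - 1\<close>.
\<close>
lemma generic_region_sum_charpoly:
  assumes "is_unsigned_charpoly L A p" "arrangement L A"
  shows "\<forall>\<^sub>F x in generic. region_sum k L A x = coeff p k"
  using assms
proof (induction rule: is_unsigned_charpoly.induct)
  case (singleton L H)
  then have L: "subspace L" and H: "subspace H" "dim L = dim H + 1"
    by (auto simp: arrangement_def)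
  have "deletion {H} H = {}" "restriction {H} H = {}"
    by (auto simp: deletion_def restriction_def)
  then show ?case
    using generic_region_sum_deletion_restriction[OF singleton, of H k]
    by (simp add: region_sum_empty L H of_bool_def coeff_monom eq_commute)
next
  case (step H A L p q)
  have "\<forall>\<^sub>F x in generic. region_sum k L (deletion A H) x = coeff p k"
    using arrangement_deletion step by blast
  moreover have "\<forall>\<^sub>F x in generic. region_sum k H (restriction A H) x = coeff q k"
    using arrangement_restriction step by blast
  ultimately show ?case
    using generic_region_sum_deletion_restriction[OF step.prems step.hyps(1), of k]
    by eventually_elim simp
qed

text \<open>
  The sum over cones may be taken over regions instead: a region is the relative interior of its closure,
  so distinct regions have distinct closures.
\<close>
lemma V_fan_arrangement_fan:
  fixes L :: "'a::euclidean_space set"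
  assumes "arrangement L A"
  shows "V_fan k (arrangement_fan L A) x = region_sum k L A x"
    and "V_fan k (arrangement_fan L A) \<in> cone_functions"
proof -
  let ?K = "components (L - \<Union>A)"
  have L: "affine L"
    using assms by (simp add: arrangement_def subspace_imp_affine)
  have cells: "open_cell L c" if "c \<in> ?K" for c
    using arrangement_open_cells[of L A] assms that unfolding arrangement_def by blast
  have "inj_on closure ?K"
  proof (rule inj_onI)
    fix c d
    assume cd: "c \<in> ?K" "d \<in> ?K" "closure c = closure d"
    then have "rel_interior c = rel_interior d"
      using closure_eq_rel_interior_eq[of c d] cells by (auto simp: open_cell_def)
    then show "c = d"
      using open_cell_rel_interior[OF L] cells cd by metis
  qed
  then show "V_fan k (arrangement_fan L A) x = region_sum k L A x"
    unfolding V_fan_def arrangement_fan_def region_sum_def by (simp add: sum_fun_apply sum.reindex)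
  show "V_fan k (arrangement_fan L A) \<in> cone_functions"
    unfolding V_fan_def arrangement_fan_def
  proof (rule cone_functions_sum)
    fix C
    assume "C \<in> closure ` ?K"
    then have "polyhedral_cone C"
      using cells by (auto simp: open_cell_def)
    then show "V_cone k C \<in> cone_functions"
      by (rule V_cone_cone_functions)
  qed
qed

section \<open>Coefficients of the two polynomials\<close>

lemma rho_add:
  "f \<in> cone_functions \<Longrightarrow> g \<in> cone_functions \<Longrightarrow> rho (f + g) = rho f + rho g"
  by (simp add: plus_simple.abs_eq simple_rel_def lower_cone_functions_def)

lemma rho_uminus: "f \<in> cone_functions \<Longrightarrow> rho (- f) = - rho f"
  by (simp add: uminus_simple.abs_eq simple_rel_def lower_cone_functions_def)

lemma rho_zero: "rho 0 = 0"
  by (simp add: zero_simple_def)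

lemma rho_of_nat_mult:
  assumes f: "f \<in> cone_functions"
  shows "(\<lambda>x. int n * f x) \<in> cone_functions \<and> rho (\<lambda>x. int n * f x) = (\<Sum>i<n. rho f)"
proof (induction n)
  case 0
  have "(\<lambda>x. int 0 * f x) = 0"
    by (simp add: fun_eq_iff)
  then show ?case
    by (simp only: rho_zero zero_in_cone_functions) simp
next
  case (Suc n)
  have "(\<lambda>x. int (Suc n) * f x) = (\<lambda>x. int n * f x) + f"
    by (simp add: fun_eq_iff algebra_simps)
  then show ?case
    using Suc f by (simp only: rho_add cone_functions_add) simp
qed

lemma rho_int_mult:
  assumes f: "f \<in> cone_functions"
  shows "(\<lambda>x. n * f x) \<in> cone_functions" "rho (\<lambda>x. n * f x) = int_scale n (rho f)"
proof -
  have "(\<lambda>x. n * f x) \<in> cone_functions \<and> rho (\<lambda>x. n * f x) = int_scale n (rho f)"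
  proof (cases "n \<ge> 0")
    case True
    then show ?thesis
      using rho_of_nat_mult[OF f, of "nat n"] by (simp add: int_scale_def)
  next
    case False
    then have "(\<lambda>x. n * f x) = - (\<lambda>x. int (nat (- n)) * f x)"
      by (simp add: fun_eq_iff)
    then show ?thesis
      using rho_of_nat_mult[OF f, of "nat (- n)"] False
      by (simp only: cone_functions_uminus rho_uminus int_scale_def if_False simp_thms)
  qed
  then show "(\<lambda>x. n * f x) \<in> cone_functions" "rho (\<lambda>x. n * f x) = int_scale n (rho f)"
    by blast+
qed

text \<open>
  This holds in all degrees: beyond the dimension of the space there are no faces.
\<close>
lemma coeff_fan_poly: "coeff (fan_poly N) k = rho (V_fan k N)"
  for N :: "'a::euclidean_space set set"
proof (cases "k \<le> DIM('a)")
  case False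
  have "faces_of_dim k C = {}" for C :: "'a set"
  proof -
    have "aff_dim F \<noteq> int k" for F :: "'a set"
      using False aff_dim_le_DIM[of F] by linarith
    then show ?thesis
      unfolding faces_of_dim_def by blast
  qed
  then have "V_fan k N = 0"
    by (simp add: V_fan_def V_cone_def)
  with False show ?thesis
    by (simp add: fan_poly_def coeff_sum coeff_monom rho_zero)
qed (simp add: fan_poly_def coeff_sum coeff_monom)

lemma coeff_poly_scale_const: "coeff (p \<cdot>\<^sub>p [:c:]) k = int_scale (coeff p k) c"
proof -
  have "coeff (p \<cdot>\<^sub>p [:c:]) k = (\<Sum>i\<le>degree p. if i = k then int_scale (coeff p i) c else 0)"
    unfolding poly_scale_def by (simp add: coeff_sum coeff_monom)
  also have "\<dots> = int_scale (coeff p k) c"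
    by (auto simp: coeff_eq_0 int_scale_def)
  finally show ?thesis .
qed

theorem corollary3p6:
  fixes L :: "(real ^ 'd) set" and A :: "(real ^ 'd) set set"
  assumes "arrangement L A"
  shows "fan_poly (arrangement_fan L A) = unsigned_charpoly L A \<cdot>\<^sub>p [:rho (indicator UNIV):]"
proof (rule poly_eqI)
  fix k
  let ?n = "coeff (unsigned_charpoly L A) k"
  have one: "(indicator UNIV :: real ^ 'd \<Rightarrow> int) \<in> cone_functions"
    using indicator_cone_functions[OF polyhedral_cone_subspace[OF subspace_UNIV]] .
  have "is_unsigned_charpoly L A (unsigned_charpoly L A)"
    using is_unsigned_charpoly_iff[OF assms] by blast
  then have "\<forall>\<^sub>F x in generic. V_fan k (arrangement_fan L A) x = ?n * indicator UNIV x"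
    using generic_region_sum_charpoly[OF _ assms, of _ k]
    by (simp add: V_fan_arrangement_fan(1)[OF assms])
  then have "rho (V_fan k (arrangement_fan L A)) = rho (\<lambda>x. ?n * indicator UNIV x)"
    by (rule rho_eq_if_generically_eq[OF V_fan_arrangement_fan(2)[OF assms] rho_int_mult(1)[OF one]])
  then show "coeff (fan_poly (arrangement_fan L A)) k =
      coeff (unsigned_charpoly L A \<cdot>\<^sub>p [:rho (indicator UNIV):]) k"
    by (simp only: coeff_fan_poly coeff_poly_scale_const rho_int_mult(2)[OF one])
qed

end
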